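(* Let $G$ be a finite abelian group and let $\Gamma=\operatorname{Cay}(G,S)$ be a strongly connected Cayley digraph of out-degree $d=|S|$ and order $n=|G|$. Then, for every integer $s\ge 1$, $$ c_{s,s}(\Gamma)= c\left(\Gamma^{[s]}\right)\le \min\left\{\sqrt{\frac{2}{e(\sqrt2-1)}}\,\sqrt n+2,\ \binom{d+s}{s}\right\}. $$ If $S=-S$, the right-hand side may be replaced by $$ \min\left\{\frac{1}{\sqrt{e(\sqrt2-1)}}\,\sqrt n+\frac72,\ \left\lceil\frac12\binom{d+s}{s}\right\rceil\right\}. $$
   Context: Cayley digraphs: $G$ is a nontrivial finite abelian group written additively ($|G|\ge 2$), $S\subseteq G\setminus\{0\}$, and $\operatorname{Cay}(G,S)$ is the digraph with vertex set $G$ and an arc $x\to x+g$ for every $x\in G$, $g\in S$. It is strongly connected if and only if $S$ generates $G$. When $S=-S$ it is regarded as an undirected graph; an undirected graph is identified with the symmetric digraph obtained by replacing each edge by two opposite arcs. The $(r,s)$ game on a finite digraph $\Gamma$: the cops choose their initial vertices first, then the robber chooses its initial vertex. Thereafter players alternate, the cops moving first in each round. On the cops' move each cop (of speed $r$) may remain where it is or move along a directed path of length at most $r$. On the robber's move, the robber (of speed $s$) may remain where it is or move along a directed path of length at most $s$ no vertex of which (including the terminal vertex) is occupied by a cop. A directed path is a vertex sequence without repetition whose consecutive vertices are joined by arcs in the forward direction; its length is its number of arcs, and length zero is allowed. Capture occurs as soon as a cop and the robber occupy the same vertex. $c_{r,s}(\Gamma)$ is the least number of speed-$r$ cops that guarantee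 capture of a speed-$s$ robber. $c(\Gamma)$ is the ordinary cop number, i.e. the minimum number of cops guaranteeing capture in the game where cops and robber all have speed one. $\Gamma^{[s]}$ is the digraph on $V(\Gamma)$ with an arc $x\to y$ whenever $x\ne y$ and the directed distance from $x$ to $y$ in $\Gamma$ is at most $s$. *)

theory Defs
  imports Complex_Main "HOL-Library.Cardinality" "Graph_Theory.Graph_Theory"
begin

definition cayley :: "'a::ab_group_add set \<Rightarrow> 'a pair_pre_digraph" where
  "cayley S = \<lparr>pverts = UNIV, parcs = {(x, x + g) | x g. g \<in> S}\<rparr>"

text \<open>
  With all arc weights equal to 1, \<open>wf_digraph.\<mu>\<close> is the directed distance.  It is specified only
  for digraphs whose arcs end in their vertex set.
\<close>

definition power_digraph :: "('a, 'b) pre_digraph \<Rightarrow> nat \<Rightarrow> 'a pair_pre_digraph" where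
  "power_digraph \<Gamma> s = \<lparr>pverts = verts \<Gamma>,
     parcs = {(x, y). x \<in> verts \<Gamma> \<and> y \<in> verts \<Gamma> \<and> x \<noteq> y \<and>
                      wf_digraph.\<mu> \<Gamma> (\<lambda>_. 1) x y \<le> ereal (real s)}\<rparr>"

lemma wf_digraph_cayley: "wf_digraph (cayley S)"
  by unfold_locales (auto simp: cayley_def)

definition travels :: "('a, 'b) pre_digraph \<Rightarrow> nat \<Rightarrow> 'a \<Rightarrow> 'a vwalk \<Rightarrow> 'a \<Rightarrow> bool" where
  "travels \<Gamma> r x p y \<longleftrightarrow> vpath p \<Gamma> \<and> vwalk_length p \<le> r \<and> hd p = x \<and> last p = y"

text \<open>
  The \<open>i\<close>-th entry of a list of cop positions is the vertex of the \<open>i\<close>-th cop, so several cops may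
  share a vertex.  Only the final vertices of the cops' paths matter for capture: a cop whose path
  runs through the robber's vertex may as well stop there.
\<close>

definition cops_move :: "('a, 'b) pre_digraph \<Rightarrow> nat \<Rightarrow> 'a list \<Rightarrow> 'a list \<Rightarrow> bool" where
  "cops_move \<Gamma> r C C' \<longleftrightarrow> list_all2 (\<lambda>x y. \<exists>p. travels \<Gamma> r x p y) C C'"

definition robber_move :: "('a, 'b) pre_digraph \<Rightarrow> nat \<Rightarrow> 'a list \<Rightarrow> 'a \<Rightarrow> 'a \<Rightarrow> bool" where
  "robber_move \<Gamma> s C x y \<longleftrightarrow> (\<exists>p. travels \<Gamma> s x p y \<and> set p \<inter> set C = {})"

text \<open>
  A strategy maps the list of all robber positions so far (oldest first) to the next cop positions;
  the empty list yields the initial placement, which precedes the robber's.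
\<close>

definition cop_strategy ::
    "('a, 'b) pre_digraph \<Rightarrow> nat \<Rightarrow> nat \<Rightarrow> ('a list \<Rightarrow> 'a list) \<Rightarrow> bool" where
  "cop_strategy \<Gamma> r k \<sigma> \<longleftrightarrow> length (\<sigma> []) = k \<and> set (\<sigma> []) \<subseteq> verts \<Gamma> \<and>
     (\<forall>h x. cops_move \<Gamma> r (\<sigma> h) (\<sigma> (h @ [x])))"

text \<open>
  In a play, \<open>\<rho> t\<close> is the robber's position after its \<open>t\<close>-th move and \<open>cops_at \<sigma> \<rho> t\<close> are the cops'
  positions after their \<open>t\<close>-th move.  The cops' move \<open>t + 1\<close> takes place while the robber is still
  at \<open>\<rho> t\<close>.
\<close>

definition cops_at :: "('a list \<Rightarrow> 'a list) \<Rightarrow> (nat \<Rightarrow> 'a) \<Rightarrow> nat \<Rightarrow> 'a list" where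
  "cops_at \<sigma> \<rho> t = \<sigma> (map \<rho> [0..<t])"

definition captured_at :: "('a list \<Rightarrow> 'a list) \<Rightarrow> (nat \<Rightarrow> 'a) \<Rightarrow> nat \<Rightarrow> bool" where
  "captured_at \<sigma> \<rho> t \<longleftrightarrow> \<rho> t \<in> set (cops_at \<sigma> \<rho> t) \<or> \<rho> t \<in> set (cops_at \<sigma> \<rho> (Suc t))"

text \<open>The robber's moves are constrained only until it is captured, since the game ends then.\<close>

definition robber_play ::
    "('a, 'b) pre_digraph \<Rightarrow> nat \<Rightarrow> ('a list \<Rightarrow> 'a list) \<Rightarrow> (nat \<Rightarrow> 'a) \<Rightarrow> bool" where
  "robber_play \<Gamma> s \<sigma> \<rho> \<longleftrightarrow> \<rho> 0 \<in> verts \<Gamma> \<and>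
     (\<forall>t. (\<forall>u\<le>t. \<not> captured_at \<sigma> \<rho> u) \<longrightarrow>
        robber_move \<Gamma> s (cops_at \<sigma> \<rho> (Suc t)) (\<rho> t) (\<rho> (Suc t)))"

definition cops_guarantee_capture :: "('a, 'b) pre_digraph \<Rightarrow> nat \<Rightarrow> nat \<Rightarrow> nat \<Rightarrow> bool" where
  "cops_guarantee_capture \<Gamma> r s k \<longleftrightarrow>
     (\<exists>\<sigma>. cop_strategy \<Gamma> r k \<sigma> \<and> (\<forall>\<rho>. robber_play \<Gamma> s \<sigma> \<rho> \<longrightarrow> (\<exists>t. captured_at \<sigma> \<rho> t)))"

definition speed_cop_number :: "nat \<Rightarrow> nat \<Rightarrow> ('a, 'b) pre_digraph \<Rightarrow> nat" where
  "speed_cop_number r s \<Gamma> = (LEAST k. cops_guarantee_capture \<Gamma> r s k)"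

abbreviation cop_number :: "('a, 'b) pre_digraph \<Rightarrow> nat" where
  "cop_number \<equiv> speed_cop_number 1 1"

text \<open>The minimum above is over a nonempty set: one cop per vertex suffices.\<close>

lemma cops_guarantee_capture_card:
  assumes "finite (verts \<Gamma>)"
  shows "cops_guarantee_capture \<Gamma> r s (card (verts \<Gamma>))"
proof -
  obtain C where C: "set C = verts \<Gamma>" "distinct C"
    using finite_distinct_list[OF assms] by blast
  have "travels \<Gamma> r x [x] x" if "x \<in> verts \<Gamma>" for x
    using that by (auto simp: travels_def vpath_def vwalk_def)
  then have "cop_strategy \<Gamma> r (card (verts \<Gamma>)) (\<lambda>_. C)"
    using C by (auto simp: cop_strategy_def cops_move_def list_all2_same distinct_card[symmetric])
  moreover have "captured_at (\<lambda>_. C) \<rho> 0" if "robber_play \<Gamma> s (\<lambda>_. C) \<rho>" for \<rho>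
    using that C by (auto simp: robber_play_def captured_at_def cops_at_def)
  ultimately show ?thesis
    unfolding cops_guarantee_capture_def by blast
qed

end

theory Submission
  imports Defs "HOL-Library.Set_Algebras"
begin

text \<open>
  Let \<open>T\<close> be the set of sums of at most \<open>s\<close> elements of \<open>S\<close>: one move in the \<open>s\<close>-th power changes
  the position by an element of \<open>T\<close>.  A cop is described by the difference \<open>d\<close> between the robber's
  position and its own.  By answering each robber move with the same move, a cop keeps its
  difference while the other cops, by induction, force the robber to use a move from any
  prescribed set whose complement they can handle.  So if \<open>D\<close> is the set of differences from which
  a cop can win with the help of the others, a difference outside \<open>D\<close> has few robber moves leading
  to \<open>D + T\<close>, and double counting bounds \<open>card (D + T) - card D\<close>.  The least value \<open>\<mu>\<close> of
  \<open>(card (D + T) - card D) / (n - card D)\<close> is attained, by submodularity, at a subgroup \<open>H\<close>, and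
  each additional cop handles a number of robber moves larger by the factor \<open>1 / (1 - \<mu>)\<close>.  The
  cops first bring one difference into \<open>H\<close>, counting robber moves modulo \<open>H\<close>, and then to \<open>0\<close>.
  If \<open>T = - T\<close>, a non-winning set of differences is periodic under \<open>a + b\<close> for the remaining
  robber moves \<open>a \<noteq> b\<close>, so that every cop takes care of two moves.
\<close>

section \<open>Sumsets and subgroups\<close>

lemma card_set_plus_translate:
  fixes A :: "'a::{ab_group_add, finite} set"
  shows "card ((+) a ` A) = card A"
  by (simp add: card_image)

lemma translate_set_plus: "(+) a ` A + B = (+) a ` (A + B)" for a :: "'a::ab_group_add"
proof -
  have "(+) a ` X = {a} + X" for X by (auto simp: set_plus_def)
  then show ?thesis by (simp add: add.assoc)
qed

text \<open>Submodularity of \<open>card (A + T)\<close> in \<open>A\<close>: unions pass through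
  the sumset exactly, while the sumset of an intersection only lies inside the intersection of the
  sumsets.\<close>

lemma card_Un_Int_set_plus:
  fixes A B T :: "'a::{ab_group_add, finite} set"
  shows "card ((A \<inter> B) + T) + card ((A \<union> B) + T) \<le> card (A + T) + card (B + T)"
proof -
  have "(A \<union> B) + T = (A + T) \<union> (B + T)"
    by (auto simp: set_plus_def)
  moreover have "card ((A \<inter> B) + T) \<le> card ((A + T) \<inter> (B + T))"
    by (intro card_mono) (auto simp: set_plus_def)
  ultimately show ?thesis
    using card_Un_Int[of "A + T" "B + T"] by simp
qed

section \<open>Subgroups and coset representatives\<close>

definition is_subgroup :: "'a::ab_group_add set \<Rightarrow> bool" where
  "is_subgroup H \<longleftrightarrow> 0 \<in> H \<and> (\<forall>x\<in>H. \<forall>y\<in>H. x - y \<in> H)"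

lemma is_subgroupD:
  assumes "is_subgroup H"
  shows "0 \<in> H" "x \<in> H \<Longrightarrow> y \<in> H \<Longrightarrow> x - y \<in> H" "x \<in> H \<Longrightarrow> y \<in> H \<Longrightarrow> x + y \<in> H"
proof -
  show "0 \<in> H" "x \<in> H \<Longrightarrow> y \<in> H \<Longrightarrow> x - y \<in> H"
    using assms by (auto simp: is_subgroup_def)
  assume xy: "x \<in> H" "y \<in> H"
  then have "0 - y \<in> H"
    using assms by (auto simp: is_subgroup_def simp del: diff_0)
  then have "x - (0 - y) \<in> H"
    using assms xy unfolding is_subgroup_def by blast
  then show "x + y \<in> H" by simp
qed

text \<open>\<open>R\<close> is a smallest part of \<open>X\<close> with
  \<open>X \<subseteq> R + H\<close>. If two of its cosets met, one representative could be dropped;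
  so the cosets are disjoint and the count is exact.\<close>

lemma subgroup_transversal:
  fixes H X :: "'a::{ab_group_add, finite} set"
  assumes "is_subgroup H"
  obtains R where "R \<subseteq> X" "X \<subseteq> R + H" "card R * card H = card (X + H)"
proof -
  note H = is_subgroupD[OF assms]
  have "X \<subseteq> X \<and> X \<subseteq> X + H"
    using H(1) by (force simp: set_plus_def)
  then obtain R where R: "R \<subseteq> X" "X \<subseteq> R + H"
    and min: "\<And>R'. R' \<subseteq> X \<and> X \<subseteq> R' + H \<Longrightarrow> card R \<le> card R'"
    using ex_has_least_nat[of "\<lambda>R. R \<subseteq> X \<and> X \<subseteq> R + H" X card] by blast
  have disj: "(+) r ` H \<inter> (+) r' ` H = {}" if r: "r \<in> R" "r' \<in> R" "r \<noteq> r'" for r r'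
  proof (rule ccontr)
    assume "(+) r ` H \<inter> (+) r' ` H \<noteq> {}"
    then obtain x y where xy: "x \<in> H" "y \<in> H" "r + x = r' + y" by auto
    have "r = r' + (y - x)" using xy(3) by (simp add: algebra_simps)
    then have *: "r + z = r' + (y - x + z)" for z by (simp add: add.assoc)
    have "R + H \<subseteq> (R - {r}) + H"
    proof
      fix w assume "w \<in> R + H"
      then obtain q z where qz: "q \<in> R" "z \<in> H" "w = q + z" by (auto simp: set_plus_def)
      show "w \<in> (R - {r}) + H"
      proof (cases "q = r")
        case True
        have "y - x + z \<in> H" using xy qz H by blast
        then show ?thesis using True qz * r by (auto simp: set_plus_def)
      qed (use qz in \<open>auto simp: set_plus_def\<close>)
    qed
    then have "card R \<le> card (R - {r})"
      using R by (intro min) auto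
    then show False
      using r by (metis card_Diff1_less finite leD)
  qed
  have "X + H = R + H"
  proof
    show "R + H \<subseteq> X + H" using R by (auto simp: set_plus_def)
    show "X + H \<subseteq> R + H"
    proof
      fix w assume "w \<in> X + H"
      then obtain x z where "x \<in> X" "z \<in> H" "w = x + z" by (auto simp: set_plus_def)
      moreover then obtain q y where "q \<in> R" "y \<in> H" "x = q + y" using R by (auto simp: set_plus_def)
      ultimately show "w \<in> R + H" using H(3) by (auto simp: set_plus_def add.assoc)
    qed
  qed
  also have "\<dots> = (\<Union>r\<in>R. (+) r ` H)" by (auto simp: set_plus_def)
  also have "card \<dots> = (\<Sum>r\<in>R. card ((+) r ` H))"
    using disj by (intro card_UN_disjoint) auto
  also have "\<dots> = card R * card H" by (simp add: card_set_plus_translate)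
  finally show ?thesis using R that by metis
qed

section \<open>The pursuit of differences\<close>

text \<open>The second assumption is generation in semigroup form; strong connectivity enters the
  pursuit only through it.\<close>

locale pursuit =
  fixes T :: "'a::{ab_group_add, finite} set"
  assumes zero_in: "0 \<in> T"
    and generates: "\<And>D. D \<noteq> {} \<Longrightarrow> D + T \<subseteq> D \<Longrightarrow> D = UNIV"
begin

lemma subset_plus: "D \<subseteq> D + T"
  using zero_in by (force simp: set_plus_def)

lemma card_plus_less:
  assumes "D \<noteq> {}" "D \<noteq> UNIV"
  shows "card D < card (D + T)"
  using assms subset_plus[of D] generates[of D] by (metis psubset_card_mono finite order.refl psubsetI)

text \<open>The cops are indexed by \<open>K\<close>, and \<open>\<delta> i\<close> is the robber's position minus that of cop \<open>i\<close>, with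
  the robber to move.  The robber may only use moves from \<open>R\<close>, and the cops want to bring some
  difference into \<open>Z\<close>.\<close>

inductive Win :: "'a set \<Rightarrow> 'a set \<Rightarrow> nat set \<Rightarrow> (nat \<Rightarrow> 'a) \<Rightarrow> bool" for Z R K where
  hit: "i \<in> K \<Longrightarrow> \<delta> i \<in> Z \<Longrightarrow> Win Z R K \<delta>"
| move: "(\<And>r. r \<in> R \<Longrightarrow> \<exists>\<delta>'. (\<forall>i\<in>K. \<delta> i + r - \<delta>' i \<in> T) \<and> Win Z R K \<delta>') \<Longrightarrow> Win Z R K \<delta>"

text \<open>All starting differences and all index sets of at least \<open>k\<close> cops are
  allowed, so a cop may be set aside and the others may start again from anywhere.\<close>

definition wins :: "'a set \<Rightarrow> 'a set \<Rightarrow> nat \<Rightarrow> bool" where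
  "wins Z R k \<longleftrightarrow> (\<forall>K \<delta>. finite K \<longrightarrow> k \<le> card K \<longrightarrow> Win Z R K \<delta>)"

lemma wins_mono: "wins Z R k \<Longrightarrow> k \<le> k' \<Longrightarrow> wins Z R k'"
  by (auto simp: wins_def)

lemma wins_empty: "wins Z {} k"
  by (auto simp: wins_def intro: Win.move)

text \<open>If a cop copies the robber's moves outside \<open>A\<close>, then \<open>k\<close> further cops winning against
  \<open>R - A\<close> force the robber to play in \<open>A\<close> eventually.\<close>

inductive approachable :: "'a set \<Rightarrow> 'a set \<Rightarrow> nat \<Rightarrow> 'a \<Rightarrow> bool" for Z R k where
  target: "d \<in> Z \<Longrightarrow> approachable Z R k d"
| forced: "A \<subseteq> R \<Longrightarrow> wins Z (R - A) k \<Longrightarrow>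
    (\<And>a. a \<in> A \<Longrightarrow> \<exists>t\<in>T. approachable Z R k (d + a - t)) \<Longrightarrow> approachable Z R k d"

text \<open>Two nested inductions: the outer one follows the approach of cop \<open>i\<close>, the
  inner one the win of the other cops against \<open>R - A\<close>. During the inner one cop
  \<open>i\<close> copies the robber; the first move in \<open>A\<close> takes it to the next
  difference of its approach, and the others start afresh.\<close>

lemma approachable_imp_Win:
  assumes "approachable Z R k d" "R \<subseteq> T" "finite K" "i \<in> K" "Suc k \<le> card K" "\<delta> i = d"
  shows "Win Z R K \<delta>"
  using assms
proof (induction arbitrary: \<delta>)
  case (target d)
  then show ?case by (auto intro: Win.hit)
next
  case (forced A d)
  have *: "Win Z (R - A) (K - {i}) \<delta>2 \<Longrightarrow>
    \<forall>\<delta>3. (\<forall>j\<in>K - {i}. \<delta>3 j = \<delta>2 j) \<longrightarrow> \<delta>3 i = d \<longrightarrow> Win Z R K \<delta>3" for \<delta>2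
  proof (induction rule: Win.induct)
    case (hit j \<delta>2)
    then show ?case by (auto intro: Win.hit)
  next
    case (move \<delta>2)
    show ?case
    proof (intro allI impI)
      fix \<delta>3 assume \<delta>3: "\<forall>j\<in>K - {i}. \<delta>3 j = \<delta>2 j" "\<delta>3 i = d"
      show "Win Z R K \<delta>3"
      proof (rule Win.move)
        fix r assume r: "r \<in> R"
        show "\<exists>\<delta>'. (\<forall>j\<in>K. \<delta>3 j + r - \<delta>' j \<in> T) \<and> Win Z R K \<delta>'"
        proof (cases "r \<in> A")
          case True
          then obtain t where t: "t \<in> T"
            "\<And>\<delta>. R \<subseteq> T \<Longrightarrow> finite K \<Longrightarrow> i \<in> K \<Longrightarrow> Suc k \<le> card K \<Longrightarrow> \<delta> i = d + r - t \<Longrightarrow> Win Z R K \<delta>"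
            using forced.IH by blast
          \<comment> \<open>Cop \<open>i\<close> answers with \<open>t\<close>; the other cops copy
            \<open>r\<close>, which is legal since \<open>R \<subseteq> T\<close>.\<close>
          have "\<forall>j\<in>K. \<delta>3 j + r - (\<delta>3(i := d + r - t)) j \<in> T"
            using t r forced.prems \<delta>3 by auto
          moreover have "Win Z R K (\<delta>3(i := d + r - t))"
            using forced.prems by (intro t(2)) auto
          ultimately show ?thesis by blast
        next
          case False
          then obtain \<delta>' where \<delta>': "\<forall>j\<in>K - {i}. \<delta>2 j + r - \<delta>' j \<in> T"
            "\<forall>\<delta>3. (\<forall>j\<in>K - {i}. \<delta>3 j = \<delta>' j) \<longrightarrow> \<delta>3 i = d \<longrightarrow> Win Z R K \<delta>3"
            using move.IH[of r] r by blast
          have "\<forall>j\<in>K. \<delta>3 j + r - (\<delta>'(i := d)) j \<in> T"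
            using \<delta>' r forced.prems \<delta>3 by auto
          moreover have "Win Z R K (\<delta>'(i := d))"
            using \<delta>'(2) by auto
          ultimately show ?thesis by blast
        qed
      qed
    qed
  qed
  have "Win Z (R - A) (K - {i}) \<delta>"
    using forced.hyps(2) forced.prems by (auto simp: wins_def)
  then show ?case using * forced.prems by auto
qed

lemma approachable_imp_wins:
  assumes "\<And>d. approachable Z R k d" "R \<subseteq> T"
  shows "wins Z R (Suc k)"
  unfolding wins_def
proof (intro allI impI)
  fix K :: "nat set" and \<delta> :: "nat \<Rightarrow> 'a"
  assume K: "finite K" "Suc k \<le> card K"
  then obtain i where "i \<in> K" by fastforce
  then show "Win Z R K \<delta>"
    using assms K by (intro approachable_imp_Win[where d = "\<delta> i"]) auto
qed

text \<open>The rule \<open>forced\<close> read backwards, with \<open>A\<close> the moves from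
  \<open>d\<close> into \<open>D + T\<close>: if \<open>d + a = x + t\<close> with
  \<open>x \<in> D\<close>, the cop answers \<open>a\<close> by \<open>t\<close> and arrives at
  \<open>x\<close>.\<close>

lemma not_approachable_exits:
  assumes "\<not> approachable Z R k d" "\<And>x. x \<in> D \<Longrightarrow> approachable Z R k x"
  shows "\<not> wins Z (R - {a \<in> R. d + a \<in> D + T}) k"
proof
  assume "wins Z (R - {a \<in> R. d + a \<in> D + T}) k"
  then have "approachable Z R k d"
  proof (rule approachable.forced[rotated])
    fix a assume "a \<in> {a \<in> R. d + a \<in> D + T}"
    then obtain x t where "x \<in> D" "t \<in> T" "d + a = x + t" by (auto simp: set_plus_def)
    then show "\<exists>t\<in>T. approachable Z R k (d + a - t)"
      using assms(2) by (intro bexI[of _ t]) auto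
  qed auto
  then show False using assms(1) by simp
qed

section \<open>Winning against a bounded number of robber moves, by double counting\<close>

definition good :: "nat \<Rightarrow> nat \<Rightarrow> bool" where
  "good m k \<longleftrightarrow> (\<forall>Z R. Z \<noteq> {} \<longrightarrow> R \<subseteq> T \<longrightarrow> card R \<le> m \<longrightarrow> wins Z R k)"

lemma goodD: "good m k \<Longrightarrow> Z \<noteq> {} \<Longrightarrow> R \<subseteq> T \<Longrightarrow> card R \<le> m \<Longrightarrow> wins Z R k"
  by (simp add: good_def)

lemma good_mono: "good m k \<Longrightarrow> m' \<le> m \<Longrightarrow> k \<le> k' \<Longrightarrow> good m' k'"
  unfolding good_def by (meson order.trans wins_mono)

lemma good_0: "good 0 k"
  by (auto simp: good_def wins_empty)

text \<open>Pairs \<open>(d, a)\<close> with \<open>d\<close> outside \<open>D\<close>,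
  \<open>a \<in> R\<close> and \<open>d + a \<in> D + T\<close> are counted in two ways. Each
  \<open>a\<close> is in \<open>card (D + T) - card D\<close> of them; each \<open>d\<close> is in
  fewer than \<open>\<mu> * m\<close>, as otherwise at most \<open>(1 - \<mu>) * m\<close> other
  moves remain and \<open>k\<close> cops deal with those. This contradicts \<open>exp\<close> unless
  \<open>D\<close> is everything.\<close>

lemma good_step_aux:
  assumes m': "\<And>m'. real m' \<le> (1 - \<mu>) * real m \<Longrightarrow> good m' k"
    and \<mu>: "0 < \<mu>" "\<mu> \<le> 1"
    and exp: "\<And>D. D \<noteq> {} \<Longrightarrow> D \<noteq> UNIV \<Longrightarrow>
      \<mu> * (real CARD('a) - real (card D)) \<le> real (card (D + T)) - real (card D)"
    and R: "Z \<noteq> {}" "R \<subseteq> T" "card R = m"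
  shows "wins Z R (Suc k)"
proof -
  define D where "D = {d. approachable Z R k d}"
  define E where "E = - D"
  have "D = UNIV"
  proof (rule ccontr)
    assume "D \<noteq> UNIV"
    have "D \<noteq> {}" using R(1) by (auto simp: D_def intro: approachable.target)
    have cE: "card E = CARD('a) - card D" "card D < CARD('a)"
      using \<open>D \<noteq> UNIV\<close> psubset_card_mono[of UNIV D]
      by (auto simp: E_def card_Diff_subset Compl_eq_Diff_UNIV)
    have exits: "real (card {a \<in> R. d + a \<in> D + T}) < \<mu> * m" if "d \<in> E" for d
    proof -
      have "\<not> wins Z (R - {a \<in> R. d + a \<in> D + T}) k"
      proof (rule not_approachable_exits)
        show "\<not> approachable Z R k d" using that unfolding E_def D_def by blast
        show "approachable Z R k x" if "x \<in> D" for x using that unfolding D_def by blast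
      qed
      then have "\<not> real (card (R - {a \<in> R. d + a \<in> D + T})) \<le> (1 - \<mu>) * m"
      proof (rule contrapos_nn)
        assume "real (card (R - {a \<in> R. d + a \<in> D + T})) \<le> (1 - \<mu>) * m"
        from m'[OF this] R(1) show "wins Z (R - {a \<in> R. d + a \<in> D + T}) k"
          by (rule goodD) (use R(2) in auto)
      qed
      moreover have "real (card (R - {a \<in> R. d + a \<in> D + T})) = m - real (card {a \<in> R. d + a \<in> D + T})"
        using R by (subst card_Diff_subset) (auto simp: of_nat_diff card_mono)
      ultimately show ?thesis by (simp add: algebra_simps)
    qed
    \<comment> \<open>The translate of \<open>D + T\<close> by \<open>- a\<close> contains
      \<open>D\<close>, because \<open>a \<in> T\<close>.\<close>
    have cT: "card {d \<in> E. d + a \<in> D + T} = card (D + T) - card D" if "a \<in> R" for a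
    proof -
      have "{d. d + a \<in> D + T} = (+) (- a) ` (D + T)"
        by (force simp: image_iff algebra_simps)
      then have "card {d. d + a \<in> D + T} = card (D + T)"
        by (simp only: card_set_plus_translate)
      moreover have "D \<subseteq> {d. d + a \<in> D + T}"
        using that R by (auto simp: set_plus_def)
      moreover have "{d \<in> E. d + a \<in> D + T} = {d. d + a \<in> D + T} - D"
        by (auto simp: E_def)
      ultimately show ?thesis by (simp add: card_Diff_subset)
    qed
    have "m * (card (D + T) - card D) = (\<Sum>a\<in>R. card {d \<in> E. d + a \<in> D + T})"
      using R(3) cT by simp
    also have "\<dots> = (\<Sum>d\<in>E. card {a \<in> R. d + a \<in> D + T})"
      by (rule sum_multicount_gen) auto
    finally have "real (m * (card (D + T) - card D)) = real (\<Sum>d\<in>E. card {a \<in> R. d + a \<in> D + T})"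
      by (rule arg_cong)
    then have "real m * real (card (D + T) - card D) = (\<Sum>d\<in>E. real (card {a \<in> R. d + a \<in> D + T}))"
      by (simp only: of_nat_mult of_nat_sum)
    also have "\<dots> < (\<Sum>d\<in>E. \<mu> * m)"
      using \<open>D \<noteq> UNIV\<close> by (intro sum_strict_mono exits) (auto simp: E_def)
    also have "\<dots> = m * (\<mu> * (real CARD('a) - real (card D)))"
      using cE by (simp add: of_nat_diff)
    also have "\<dots> \<le> m * (real (card (D + T)) - real (card D))"
      by (intro mult_left_mono exp \<open>D \<noteq> {}\<close> \<open>D \<noteq> UNIV\<close>) auto
    finally show False
      by (simp add: of_nat_diff card_mono subset_plus)
  qed
  then show ?thesis
    using R by (intro approachable_imp_wins) (auto simp: D_def)
qed

text \<open>The bound \<open>m\<close> is now a real number, so that the factor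
  \<open>1 - \<mu>\<close> can be iterated without rounding.\<close>

lemma good_step:
  assumes "\<And>m'. real m' \<le> (1 - \<mu>) * m \<Longrightarrow> good m' k"
    and \<mu>: "0 < \<mu>" "\<mu> \<le> 1"
    and exp: "\<And>D. D \<noteq> {} \<Longrightarrow> D \<noteq> UNIV \<Longrightarrow>
      \<mu> * (real CARD('a) - real (card D)) \<le> real (card (D + T)) - real (card D)"
    and "real p \<le> m"
  shows "good p (Suc k)"
  unfolding good_def
proof (intro allI impI)
  fix Z R :: "'a set" assume R: "Z \<noteq> {}" "R \<subseteq> T" "card R \<le> p"
  show "wins Z R (Suc k)"
  proof (rule good_step_aux[OF _ \<mu> exp R(1,2) refl])
    fix m' assume "real m' \<le> (1 - \<mu>) * real (card R)"
    also have "\<dots> \<le> (1 - \<mu>) * m"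
      using R assms by (intro mult_left_mono) auto
    finally show "good m' k" by (rule assms(1))
  qed
qed

lemma good_iterate:
  assumes "\<And>m'. real m' \<le> (1 - \<mu>) ^ j * m \<Longrightarrow> good m' k"
    and \<mu>: "0 < \<mu>" "\<mu> \<le> 1"
    and exp: "\<And>D. D \<noteq> {} \<Longrightarrow> D \<noteq> UNIV \<Longrightarrow>
      \<mu> * (real CARD('a) - real (card D)) \<le> real (card (D + T)) - real (card D)"
    and "real p \<le> m"
  shows "good p (j + k)"
  using assms(1,5)
proof (induction j arbitrary: m p)
  case (Suc j)
  have "good m' (j + k)" if "real m' \<le> (1 - \<mu>) * m" for m'
    using Suc.IH[OF Suc.prems(1) that] by (simp add: mult_ac)
  then show ?case
    using good_step[OF _ \<mu> exp Suc.prems(2)] by simp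
qed auto

text \<open>A proper nonempty set gains at least one element in \<open>D + T\<close>, so the
  reciprocal of the group order is an admissible \<open>\<mu>\<close>; it already saves one move for
  each further cop.\<close>

lemma good_self: "good m m"
proof (induction m)
  case (Suc m)
  let ?\<mu> = "1 / real CARD('a)"
  show ?case
  proof (cases "Suc m \<le> CARD('a)")
    case True
    show ?thesis
    proof (rule good_step[of ?\<mu> "Suc m"])
      fix m' assume "real m' \<le> (1 - ?\<mu>) * Suc m"
      also have "\<dots> < Suc m" using True by (simp add: field_simps)
      finally have "m' \<le> m" by simp
      then show "good m' m" using Suc good_mono by blast
    next
      fix D :: "'a set" assume D: "D \<noteq> {}" "D \<noteq> UNIV"
      have "?\<mu> * (real CARD('a) - real (card D)) \<le> 1" by (simp add: field_simps)
      also have "\<dots> \<le> real (card (D + T)) - real (card D)"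
        using card_plus_less[OF D] by linarith
      finally show "?\<mu> * (real CARD('a) - real (card D)) \<le> real (card (D + T)) - real (card D)" .
    qed auto
  next
    case False
    have "card R \<le> m" for R :: "'a set"
      using False card_mono[of UNIV R] by simp
    then show ?thesis
      using Suc wins_mono[of _ _ m "Suc m"] by (simp add: good_def)
  qed
qed (rule good_0)

section \<open>Reduction modulo a subgroup\<close>

lemma Win_shift:
  assumes "Win H R K \<delta>" "is_subgroup H" "R' \<subseteq> R + H" "\<forall>i\<in>K. \<delta>' i - \<delta> i \<in> H"
  shows "Win H R' K \<delta>'"
  using assms
proof (induction arbitrary: \<delta>')
  case (hit i \<delta>)
  then have "(\<delta>' i - \<delta> i) + \<delta> i \<in> H" by (blast intro: is_subgroupD(3))
  then show ?case using hit by (auto intro: Win.hit)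
next
  case (move \<delta>)
  show ?case
  proof (rule Win.move)
    fix r' assume "r' \<in> R'"
    then obtain r y where r: "r \<in> R" "y \<in> H" "r' = r + y"
      using move.prems by (auto simp: set_plus_def)
    then obtain \<delta>1 where \<delta>1: "\<forall>i\<in>K. \<delta> i + r - \<delta>1 i \<in> T"
      "\<And>\<delta>'. \<forall>i\<in>K. \<delta>' i - \<delta>1 i \<in> H \<Longrightarrow> Win H R' K \<delta>'"
      using move.IH move.prems by blast
    \<comment> \<open>Each cop makes the same step as in the play from \<open>\<delta>\<close>; the
      robber's step differs by an element of \<open>H\<close>, so the differences stay congruent
      modulo \<open>H\<close>.\<close>
    define \<delta>2 where "\<delta>2 i = \<delta>' i + r' - (\<delta> i + r - \<delta>1 i)" for i
    have "\<delta>2 i - \<delta>1 i \<in> H" if "i \<in> K" for i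
    proof -
      have "\<delta>2 i - \<delta>1 i = (\<delta>' i - \<delta> i) + y"
        by (simp add: \<delta>2_def r algebra_simps)
      then show ?thesis using move.prems that r by (auto intro: is_subgroupD(3))
    qed
    moreover have "\<forall>i\<in>K. \<delta>' i + r' - \<delta>2 i \<in> T"
      using \<delta>1(1) by (simp add: \<delta>2_def)
    ultimately show "\<exists>\<delta>2. (\<forall>i\<in>K. \<delta>' i + r' - \<delta>2 i \<in> T) \<and> Win H R' K \<delta>2"
      using \<delta>1(2) by blast
  qed
qed

text \<open>For the target \<open>H\<close> only cosets matter, so robber moves congruent modulo
  \<open>H\<close> count as one.\<close>

lemma wins_transversal:
  assumes "wins H R k" "is_subgroup H" "R' \<subseteq> R + H"
  shows "wins H R' k"
  using assms Win_shift[of H R _ _ R'] is_subgroupD(1)[OF assms(2)] unfolding wins_def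
  by (metis diff_self)

lemma Win_retarget:
  assumes "Win Z R K \<delta>" "\<And>\<delta> i. i \<in> K \<Longrightarrow> \<delta> i \<in> Z \<Longrightarrow> Win Z' R K \<delta>"
  shows "Win Z' R K \<delta>"
  using assms(1)
proof induction
  case (hit i \<delta>)
  then show ?case by (rule assms(2))
next
  case (move \<delta>)
  then show ?case by (metis Win.move)
qed

text \<open>Once a cop is in the subgroup \<open>H\<close> it can stay there; a pair of a difference in \<open>H - D\<close> and
  a robber move that does not lead back to \<open>D\<close> is determined by the difference and an element of
  \<open>(H + T) - (D + T)\<close>.\<close>

lemma wins_descend:
  assumes "wins H T (Suc k)" "is_subgroup H"
    and good: "\<And>m'. real m' \<le> (1 - \<mu>) * real (card H) \<Longrightarrow> good m' k"
    and \<mu>: "0 < \<mu>" "\<mu> \<le> 1" "H \<noteq> UNIV"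
    and exp: "\<And>D. D \<noteq> {} \<Longrightarrow> D \<noteq> UNIV \<Longrightarrow>
      \<mu> * (real CARD('a) - real (card D)) \<le> real (card (D + T)) - real (card D)"
    and eq: "\<mu> * (real CARD('a) - real (card H)) = real (card (H + T)) - real (card H)"
  shows "wins {0} T (Suc k)"
proof -
  note H = is_subgroupD[OF assms(2)]
  define D where "D = {d \<in> H. approachable {0} T k d}"
  have "D = H"
  proof (rule ccontr)
    assume "D \<noteq> H"
    have DH: "D \<subset> H" using \<open>D \<noteq> H\<close> by (auto simp: D_def)
    have "0 \<in> D" using H by (auto simp: D_def intro: approachable.target)
    have "D \<noteq> UNIV" using DH by auto
    have mono: "D + T \<subseteq> H + T" using DH by (auto simp: set_plus_def)
    have exits: "(1 - \<mu>) * card H < real (card {a \<in> T. d + a \<notin> D + T})" if "d \<in> H - D" for d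
    proof -
      have "\<not> wins {0} (T - {a \<in> T. d + a \<in> D + T}) k"
      proof (rule not_approachable_exits)
        show "\<not> approachable {0} T k d" using that unfolding D_def by blast
        show "approachable {0} T k x" if "x \<in> D" for x using that unfolding D_def by blast
      qed
      then have "\<not> real (card (T - {a \<in> T. d + a \<in> D + T})) \<le> (1 - \<mu>) * card H"
      proof (rule contrapos_nn)
        assume "real (card (T - {a \<in> T. d + a \<in> D + T})) \<le> (1 - \<mu>) * card H"
        from good[OF this] show "wins {0} (T - {a \<in> T. d + a \<in> D + T}) k"
          by (rule goodD) auto
      qed
      moreover have "T - {a \<in> T. d + a \<in> D + T} = {a \<in> T. d + a \<notin> D + T}" by auto
      ultimately show ?thesis by simp
    qed
    have "(1 - \<mu>) * card H * (real (card H) - real (card D)) = (\<Sum>d\<in>H - D. (1 - \<mu>) * card H)"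
      using DH by (simp add: card_Diff_subset of_nat_diff card_mono less_imp_le)
    also have "\<dots> < (\<Sum>d\<in>H - D. real (card {a \<in> T. d + a \<notin> D + T}))"
      using DH by (intro sum_strict_mono exits) auto
    also have "\<dots> \<le> (\<Sum>d\<in>H. real (card {a \<in> T. d + a \<notin> D + T}))"
      by (intro sum_mono2) auto
    also have "\<dots> \<le> (\<Sum>d\<in>H. real (card ((H + T) - (D + T))))"
    proof (rule sum_mono)
      fix d assume "d \<in> H"
      have "card {a \<in> T. d + a \<notin> D + T} = card ((+) d ` {a \<in> T. d + a \<notin> D + T})"
        by (simp add: card_set_plus_translate)
      also have "\<dots> \<le> card ((H + T) - (D + T))"
        using \<open>d \<in> H\<close> by (intro card_mono) auto
      finally show "real (card {a \<in> T. d + a \<notin> D + T}) \<le> real (card ((H + T) - (D + T)))"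
        by simp
    qed
    also have "\<dots> = card H * (real (card (H + T)) - real (card (D + T)))"
      using mono by (simp add: card_Diff_subset of_nat_diff card_mono)
    \<comment> \<open>Subtracting \<open>exp\<close> at \<open>D\<close> from the equality
      \<open>eq\<close> at \<open>H\<close> bounds from above what \<open>H + T\<close> has beyond
      \<open>D + T\<close>.\<close>
    also have "\<dots> \<le> card H * ((1 - \<mu>) * (real (card H) - real (card D)))"
    proof (rule mult_left_mono)
      have "D \<noteq> {}" using \<open>0 \<in> D\<close> by auto
      from exp[OF this \<open>D \<noteq> UNIV\<close>] eq
      show "real (card (H + T)) - real (card (D + T)) \<le> (1 - \<mu>) * (real (card H) - real (card D))"
        by (simp add: algebra_simps)
    qed simp
    finally show False by (simp add: mult_ac)
  qed
  then have app: "approachable {0} T k d" if "d \<in> H" for d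
    using that by (auto simp: D_def)
  show ?thesis
    unfolding wins_def
  proof (intro allI impI)
    fix K :: "nat set" and \<delta> :: "nat \<Rightarrow> 'a"
    assume K: "finite K" "Suc k \<le> card K"
    then have "Win H T K \<delta>" using assms(1) by (auto simp: wins_def)
    then show "Win {0} T K \<delta>"
    proof (rule Win_retarget)
      fix \<delta> :: "nat \<Rightarrow> 'a" and i assume "i \<in> K" "\<delta> i \<in> H"
      then show "Win {0} T K \<delta>"
        using K app by (intro approachable_imp_Win[where d = "\<delta> i"]) auto
    qed
  qed
qed

text \<open>The defect \<open>\<phi>\<close> is submodular, nonnegative on nonempty sets and translation invariant, so
  the zero sets of least cardinality are pairwise equal or disjoint translates of each other.\<close>

lemma least_expanding_subgroup:
  assumes "CARD('a) \<ge> 2"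
  obtains H \<mu> where "is_subgroup H" "H \<noteq> UNIV" "0 < \<mu>" "\<mu> \<le> 1"
    "\<And>D. D \<noteq> {} \<Longrightarrow> D \<noteq> UNIV \<Longrightarrow>
      \<mu> * (real CARD('a) - real (card D)) \<le> real (card (D + T)) - real (card D)"
    "\<mu> * (real CARD('a) - real (card H)) = real (card (H + T)) - real (card H)"
proof -
  define f where "f D = (real (card (D + T)) - real (card D)) / (real CARD('a) - real (card D))" for D :: "'a set"
  define P where "P = {D :: 'a set. D \<noteq> {} \<and> D \<noteq> UNIV}"
  have "{0} \<noteq> (UNIV :: 'a set)"
  proof
    assume "{0} = (UNIV :: 'a set)"
    then have "CARD('a) = card {0 :: 'a}" by simp
    then show False using assms by simp
  qed
  then have "{0} \<in> P" by (simp add: P_def)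
  define \<mu> where "\<mu> = Min (f ` P)"
  have pos: "real CARD('a) - real (card D) > 0" if "D \<in> P" for D
    using that psubset_card_mono[of UNIV D] by (auto simp: P_def)
  have "\<mu> \<in> f ` P" unfolding \<mu>_def using \<open>{0} \<in> P\<close> by (intro Min_in) auto
  then obtain D0 where D0: "D0 \<in> P" "\<mu> = f D0" by auto
  have le: "\<mu> \<le> f D" if "D \<in> P" for D unfolding \<mu>_def using that by (intro Min_le) auto
  define \<phi> where "\<phi> D = real (card (D + T)) - real (card D) - \<mu> * (real CARD('a) - real (card D))" for D
  have UNIV: "UNIV + T = UNIV" using subset_plus[of UNIV] by auto
  \<comment> \<open>\<open>UNIV\<close> is included because the union of two overlapping zero sets
    may be the whole group; its defect is \<open>0\<close>.\<close>
  have \<phi>: "\<phi> D \<ge> 0" if "D \<noteq> {}" for D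
  proof (cases "D = UNIV")
    case True
    then show ?thesis by (simp add: \<phi>_def UNIV)
  next
    case False
    then have "D \<in> P" using that by (auto simp: P_def)
    then show ?thesis using le[of D] pos[of D] by (auto simp: f_def \<phi>_def field_simps)
  qed
  have "D0 \<in> P \<and> \<phi> D0 = 0" using D0 pos[of D0] by (auto simp: f_def \<phi>_def field_simps)
  then obtain A where A: "A \<in> P" "\<phi> A = 0"
    and min: "\<And>D. D \<in> P \<and> \<phi> D = 0 \<Longrightarrow> card A \<le> card D"
    using ex_has_least_nat[of "\<lambda>D. D \<in> P \<and> \<phi> D = 0" D0 card] by blast
  have \<phi>_trans: "\<phi> ((+) x ` D) = \<phi> D" for x D
    by (simp add: \<phi>_def translate_set_plus card_set_plus_translate)
  have P_trans: "(+) x ` D \<in> P" if "D \<in> P" for x D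
    using that pos[OF that] card_set_plus_translate[of x D] by (auto simp: P_def)
  obtain a where "a \<in> A" using A by (auto simp: P_def)
  define H where "H = (+) (- a) ` A"
  have H: "H \<in> P" "\<phi> H = 0" "card H = card A" "0 \<in> H"
    unfolding H_def using A P_trans[of A "- a"] \<phi>_trans[of "- a" A] \<open>a \<in> A\<close>
    by (simp_all only: card_set_plus_translate) (simp add: image_iff)
  have sub: "x - y \<in> H" if "x \<in> H" "y \<in> H" for x y
  proof -
    \<comment> \<open>The translate contains \<open>0\<close> and so meets \<open>H\<close>. By
      submodularity the intersection has defect \<open>0\<close>, and by minimality it equals both
      sets; \<open>x - y\<close> lies in the translate.\<close>
    let ?H = "(+) (- y) ` H"
    have "0 \<in> ?H" using that(2) by (auto simp: image_iff)
    then have ne: "H \<inter> ?H \<noteq> {}" using H(4) by blast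
    have le: "\<phi> (H \<inter> ?H) + \<phi> (H \<union> ?H) \<le> \<phi> H + \<phi> ?H"
    proof -
      have "real (card (H \<inter> ?H)) + real (card (H \<union> ?H)) = real (card H) + real (card ?H)"
        using card_Un_Int[of H ?H] by simp
      moreover have "real (card ((H \<inter> ?H) + T)) + real (card ((H \<union> ?H) + T))
          \<le> real (card (H + T)) + real (card (?H + T))"
        using card_Un_Int_set_plus[of H ?H T] by linarith
      moreover have "\<mu> * real (card (H \<inter> ?H)) + \<mu> * real (card (H \<union> ?H))
          = \<mu> * real (card H) + \<mu> * real (card ?H)"
        using calculation(1) by (metis distrib_left)
      ultimately show ?thesis by (simp add: \<phi>_def algebra_simps)
    qed
    have "\<phi> (H \<inter> ?H) = 0"
    proof -
      have "H \<union> ?H \<noteq> {}" using H(4) by blast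
      then show ?thesis
        using \<phi>[OF ne] \<phi>[of "H \<union> ?H"] H(2) \<phi>_trans[of "- y" H] le by linarith
    qed
    moreover have "H \<inter> ?H \<in> P" using ne H(1) by (auto simp: P_def)
    ultimately have "card H \<le> card (H \<inter> ?H)" using min H(3) by auto
    then have "H \<inter> ?H = H" by (intro card_seteq) auto
    moreover have "H \<inter> ?H = ?H"
      using \<open>card H \<le> _\<close> by (intro card_seteq) (simp_all only: card_set_plus_translate finite Int_lower2)
    moreover have "x - y \<in> ?H" using that(1) by (auto simp: image_iff)
    ultimately show ?thesis by auto
  qed
  have "0 < \<mu>"
    using D0 card_plus_less[of D0] pos[of D0] by (auto simp: f_def P_def)
  moreover have "\<mu> \<le> 1"
    using D0 pos[of D0] card_mono[of UNIV "D0 + T"] by (auto simp: f_def)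
  moreover have "is_subgroup H" using H(4) sub by (auto simp: is_subgroup_def)
  ultimately show ?thesis
    using \<phi> H by (intro that[of H \<mu>]) (auto simp: \<phi>_def P_def)
qed

end

section \<open>Numerical estimates\<close>

text \<open>This is \<open>ln v \<le> v - 1\<close> at \<open>v = sqrt (w / exp 1)\<close>, with
  equality for \<open>w = exp 1\<close>.\<close>

lemma one_plus_ln_le:
  fixes w :: real
  assumes "w > 0"
  shows "1 + ln w \<le> 2 / sqrt (exp 1) * sqrt w"
proof -
  let ?v = "sqrt w / sqrt (exp 1)"
  have "ln ?v \<le> ?v - 1"
    using assms by (intro ln_le_minus_one) auto
  moreover have "ln ?v = (ln w - 1) / 2"
    using assms by (simp add: ln_div ln_sqrt)
  ultimately show ?thesis by (simp add: field_simps)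
qed

text \<open>Up to rounding, \<open>j = ln (\<mu> * m) / \<mu>\<close> minimises
  \<open>j + exp (- \<mu> * j) * m\<close>; the minimum is
  \<open>(1 + ln (\<mu> * m)) / \<mu>\<close>, and rounding up costs the summand \<open>1\<close>.
  When \<open>\<mu> * m < 1\<close>, \<open>j = 0\<close> suffices.\<close>

lemma decay_bound:
  fixes \<mu> m :: real
  assumes "0 < \<mu>" "\<mu> \<le> 1" "0 \<le> m"
  obtains j :: nat where "real j + (1 - \<mu>) ^ j * m \<le> 1 + 2 / sqrt (exp 1) * sqrt (m / \<mu>)"
proof (cases "\<mu> * m < 1")
  case True
  have "sqrt (exp 1) \<le> sqrt 4"
    using exp_le by (intro real_sqrt_le_mono) simp
  then have ge1: "1 \<le> 2 / sqrt (exp 1)" by simp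
  have "m * (\<mu> * m) \<le> m * 1" using True assms by (intro mult_left_mono) auto
  then have "m \<^sup>2 \<le> m / \<mu>" using assms by (simp add: field_simps power2_eq_square)
  then have "m \<le> sqrt (m / \<mu>)" using real_le_rsqrt by blast
  also have "\<dots> \<le> 2 / sqrt (exp 1) * sqrt (m / \<mu>)"
    using mult_right_mono[OF ge1, of "sqrt (m / \<mu>)"] assms by simp
  finally show ?thesis by (intro that[of 0]) simp
next
  case False
  define w where "w = \<mu> * m"
  have w: "1 \<le> w" using False by (simp add: w_def)
  define j where "j = nat \<lceil>ln w / \<mu>\<rceil>"
  have "0 \<le> ln w / \<mu>" using w assms by simp
  then have j: "ln w / \<mu> \<le> j" "j \<le> ln w / \<mu> + 1"
    unfolding j_def by linarith+
  have "(1 - \<mu>) ^ j \<le> exp (- \<mu>) ^ j"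
    using assms exp_ge_add_one_self[of "- \<mu>"] by (intro power_mono) auto
  also have "\<dots> = exp (- (\<mu> * j))" by (simp add: exp_of_nat_mult[symmetric] mult.commute)
  also have "\<dots> \<le> exp (- ln w)" using j(1) assms by (simp add: field_simps)
  also have "\<dots> = 1 / w" using w by (simp add: exp_minus field_simps)
  finally have "(1 - \<mu>) ^ j * m \<le> 1 / w * m" using assms by (intro mult_right_mono)
  also have "\<dots> = 1 / \<mu>" using w assms by (auto simp: w_def field_simps)
  finally have "real j + (1 - \<mu>) ^ j * m \<le> 1 + (1 + ln w) / \<mu>"
    using j(2) by (simp add: add_divide_distrib)
  also have "(1 + ln w) / \<mu> \<le> (2 / sqrt (exp 1) * sqrt w) / \<mu>"
    using one_plus_ln_le[of w] w assms by (intro divide_right_mono) auto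
  also have "\<dots> = 2 / sqrt (exp 1) * (sqrt w / \<mu>)" by simp
  also have "sqrt w / \<mu> = sqrt (w / \<mu>\<^sup>2)" using assms by (simp add: real_sqrt_divide)
  also have "w / \<mu>\<^sup>2 = m / \<mu>" using assms by (simp add: w_def power2_eq_square)
  finally show ?thesis using that by simp
qed

definition directed_const :: real where
  "directed_const = sqrt (2 / (exp 1 * (sqrt 2 - 1)))"

lemma directed_const_bounds: "0 \<le> directed_const" "3 / 2 \<le> directed_const\<^sup>2"
  and sqrt_le_directed_const: "0 \<le> y \<Longrightarrow> x \<le> 6 / 5 * y \<Longrightarrow>
    2 / sqrt (exp 1) * sqrt x \<le> directed_const * sqrt y"
proof -
  \<comment> \<open>The bound \<open>17 / 12\<close> gives
    \<open>2 / (sqrt 2 - 1) \<ge> 24 / 5\<close>, exactly the \<open>4 * (6 / 5)\<close> wanted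
    below.\<close>
  have s: "sqrt 2 \<le> 17 / 12" "1 < sqrt (2 :: real)"
    by (rule real_le_lsqrt; simp add: power2_eq_square) simp
  have e: "0 < exp (1 :: real)" "exp (1 :: real) \<le> 3" using exp_le by auto
  have pos: "0 < exp 1 * (sqrt 2 - 1 :: real)" using s e by simp
  then show "0 \<le> directed_const" by (simp add: directed_const_def)
  have "exp 1 * (sqrt 2 - 1) \<le> 3 * (17 / 12 - 1 :: real)"
    using s e by (intro mult_mono) auto
  then have "3 / 2 \<le> 2 / (exp 1 * (sqrt 2 - 1) :: real)"
    using pos by (simp add: pos_le_divide_eq)
  then show "3 / 2 \<le> directed_const\<^sup>2" using pos by (simp add: directed_const_def)
  assume xy: "0 \<le> y" "x \<le> 6 / 5 * y"
  have "2 / sqrt (exp 1) * sqrt x = sqrt (4 / exp 1 * x)"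
    by (simp add: real_sqrt_mult real_sqrt_divide)
  also have "4 / exp 1 * x \<le> 4 / exp 1 * (6 / 5 * y)"
    using xy e by (intro mult_left_mono) auto
  also have "\<dots> = 4 / exp 1 * (6 / 5) * y" by simp
  also have "4 / exp 1 * (6 / 5) \<le> 2 / (exp 1 * (sqrt 2 - 1) :: real)"
    using s e by (simp add: field_simps)
  then have "4 / exp 1 * (6 / 5) * y \<le> 2 / (exp 1 * (sqrt 2 - 1)) * y"
    using xy by (intro mult_right_mono)
  finally have "2 / sqrt (exp 1) * sqrt x \<le> sqrt (2 / (exp 1 * (sqrt 2 - 1)) * y)"
    by simp
  then show "2 / sqrt (exp 1) * sqrt x \<le> directed_const * sqrt y"
    by (simp only: directed_const_def real_sqrt_mult)
qed

section \<open>Square root bounds from the counting lemmas\<close>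

context pursuit
begin

text \<open>\<open>h\<close> is the order of the subgroup \<open>H\<close>, \<open>N\<close> its
  index and \<open>u\<close> the number of its cosets met by \<open>T\<close>. The equality at
  \<open>H\<close> becomes \<open>\<mu> * (N - 1) = u - 1\<close>, whence the ratios.
  \<open>k\<close> cops suffice to reach \<open>H\<close>, and \<open>k' + 1\<close> to go on from
  there to \<open>0\<close>.\<close>

lemma wins_from_good:
  assumes "CARD('a) \<ge> 2"
  obtains \<mu> and h u N :: nat where "0 < \<mu>" "\<mu> \<le> 1" "2 \<le> u" "u \<le> N" "1 \<le> h"
    "CARD('a) = N * h" "u = N \<Longrightarrow> \<mu> = 1"
    "6 \<le> u \<Longrightarrow> real u / \<mu> \<le> 6 / 5 * real N" "real h / \<mu> \<le> 6 / 5 * real CARD('a)"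
    "\<And>D. D \<noteq> {} \<Longrightarrow> D \<noteq> UNIV \<Longrightarrow>
      \<mu> * (real CARD('a) - real (card D)) \<le> real (card (D + T)) - real (card D)"
    "\<And>k k'. good u k \<Longrightarrow> good h k' \<Longrightarrow> wins {0} T (max k (Suc k'))"
proof -
  obtain H \<mu> where H: "is_subgroup H" "H \<noteq> UNIV" and \<mu>: "0 < \<mu>" "\<mu> \<le> 1"
    and exp: "\<And>D. D \<noteq> {} \<Longrightarrow> D \<noteq> UNIV \<Longrightarrow>
      \<mu> * (real CARD('a) - real (card D)) \<le> real (card (D + T)) - real (card D)"
    and eq: "\<mu> * (real CARD('a) - real (card H)) = real (card (H + T)) - real (card H)"
    using least_expanding_subgroup[OF assms] by blast
  have "H \<noteq> {}" using is_subgroupD(1)[OF H(1)] by auto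
  then have h: "1 \<le> card H" by (simp add: Suc_le_eq card_gt_0_iff)
  obtain R where R: "R \<subseteq> T" "T \<subseteq> R + H" "card R * card H = card (T + H)"
    using subgroup_transversal[OF H(1), of T] by metis
  obtain Q :: "'a set" where Q: "card Q * card H = card (UNIV + H)"
    using subgroup_transversal[OF H(1), of UNIV] by metis
  have "(UNIV :: 'a set) + H = UNIV"
    using is_subgroupD(1)[OF H(1)] by (force simp: set_plus_def)
  then have n: "CARD('a) = card Q * card H" using Q by simp
  have "card H < card R * card H"
    using card_plus_less[OF \<open>H \<noteq> {}\<close> H(2)] R(3) by (simp add: add.commute)
  then have "2 \<le> card R" by (metis Suc_1 Suc_leI mult_1 mult_less_cancel2)
  have "card R * card H \<le> card Q * card H"
    using R(3) n card_mono[of UNIV "T + H"] by simp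
  then have "card R \<le> card Q" using h by simp
  have "\<mu> * (real (card Q) - 1) * real (card H) = (real (card R) - 1) * real (card H)"
    using eq n R(3) by (simp add: add.commute algebra_simps flip: of_nat_mult)
  then have mu: "\<mu> * (real (card Q) - 1) = real (card R) - 1" using \<open>H \<noteq> {}\<close> by simp
  have wins: "wins {0} T (max k (Suc k'))" if "good (card R) k" "good (card H) k'" for k k'
  proof -
    obtain q where q: "max k (Suc k') = Suc q" "k' \<le> q" by (metis max.cobounded2 Suc_le_D Suc_le_mono)
    have "wins H R k" using that(1) \<open>H \<noteq> {}\<close> R by (intro goodD) auto
    then have "wins H T k" by (rule wins_transversal[OF _ H(1) R(2)])
    then have "wins H T (Suc q)" by (rule wins_mono) (use q in linarith)
    then have "wins {0} T (Suc q)"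
    proof (rule wins_descend[OF _ H(1) _ \<mu> H(2) exp eq])
      fix m' assume "real m' \<le> (1 - \<mu>) * real (card H)"
      also have "\<dots> \<le> 1 * real (card H)" using \<mu> by (intro mult_right_mono) auto
      finally have "m' \<le> card H" by simp
      then show "good m' q" using good_mono[OF that(2) _ q(2)] by simp
    qed
    then show ?thesis by (simp add: q)
  qed
  have inv: "1 / \<mu> = (real (card Q) - 1) / (real (card R) - 1)"
    using mu \<mu> \<open>2 \<le> card R\<close> by (simp add: field_simps)
  have Rmu: "real (card R) / \<mu> \<le> 6 / 5 * real (card Q)" if "6 \<le> card R"
  proof -
    have "real (card R) / \<mu> = real (card R) / (real (card R) - 1) * (real (card Q) - 1)"
      using inv by (simp add: divide_inverse)
    also have "\<dots> \<le> 6 / 5 * real (card Q)"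
      using that \<open>card R \<le> card Q\<close> by (intro mult_mono) (auto simp: field_simps)
    finally show ?thesis .
  qed
  have Hmu: "real (card H) / \<mu> \<le> 6 / 5 * real CARD('a)"
  proof -
    have "(real (card Q) - 1) / (real (card R) - 1) \<le> (real (card Q) - 1) / 1"
      using \<open>2 \<le> card R\<close> \<open>card R \<le> card Q\<close> by (intro divide_left_mono) auto
    then have "1 / \<mu> \<le> real (card Q)" using inv by simp
    then have "real (card H) * (1 / \<mu>) \<le> real (card H) * real (card Q)"
      by (intro mult_left_mono) auto
    also have "\<dots> \<le> 6 / 5 * real CARD('a)" by (simp add: n)
    finally show ?thesis by simp
  qed
  have full: "\<mu> = 1" if "card R = card Q"
    using mu that \<open>2 \<le> card R\<close> by simp
  show ?thesis
    by (rule that[OF \<mu> \<open>2 \<le> card R\<close> \<open>card R \<le> card Q\<close> h n full Rmu Hmu exp wins])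
qed

text \<open>Here \<open>\<mu> = 1\<close>, so the first cop leaves no robber moves to deal
  with.\<close>

lemma good_one_if_full:
  assumes exp: "\<And>D. D \<noteq> {} \<Longrightarrow> D \<noteq> UNIV \<Longrightarrow>
      real CARD('a) - real (card D) \<le> real (card (D + T)) - real (card D)"
  shows "good p 1"
  using good_step[of 1 p 0 p] exp good_0 by simp

text \<open>\<open>j\<close> cops cut the \<open>p\<close> moves down by the factor
  \<open>(1 - \<mu>) ^ j\<close>, and \<open>f\<close> handles the rest. It is applied with
  \<open>f m = m\<close> and, for symmetric \<open>T\<close>, with
  \<open>f m = m div 2 + 1\<close>.\<close>

lemma good_bound:
  assumes \<mu>: "0 < \<mu>" "\<mu> \<le> 1"
    and exp: "\<And>D. D \<noteq> {} \<Longrightarrow> D \<noteq> UNIV \<Longrightarrow>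
      \<mu> * (real CARD('a) - real (card D)) \<le> real (card (D + T)) - real (card D)"
    and f: "\<And>m. good m (f m)" "\<And>m. real (f m) \<le> a * real m + b"
    and "0 \<le> a"
  obtains k where "good p k" "real k \<le> 1 + 2 / sqrt (exp 1) * sqrt (a * p / \<mu>) + b"
proof -
  obtain j where j: "real j + (1 - \<mu>) ^ j * (a * p) \<le> 1 + 2 / sqrt (exp 1) * sqrt (a * p / \<mu>)"
    using decay_bound[OF \<mu>, of "a * p"] \<open>0 \<le> a\<close> by auto
  let ?q = "nat \<lfloor>(1 - \<mu>) ^ j * p\<rfloor>"
  have q: "real ?q \<le> (1 - \<mu>) ^ j * p" "\<And>m'. real m' \<le> (1 - \<mu>) ^ j * p \<Longrightarrow> m' \<le> ?q"
    using \<mu> by (simp, linarith)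
  have "good p (j + f ?q)"
    using good_mono[OF f(1)] q(2) by (intro good_iterate[OF _ \<mu> exp order_refl]) auto
  moreover have "real (f ?q) \<le> a * ((1 - \<mu>) ^ j * p) + b"
    using f(2)[of ?q] mult_left_mono[OF q(1) \<open>0 \<le> a\<close>] by linarith
  then have "real (j + f ?q) \<le> 1 + 2 / sqrt (exp 1) * sqrt (a * p / \<mu>) + b"
    using j by (simp add: mult.left_commute)
  ultimately show ?thesis using that by blast
qed

text \<open>The ratio \<open>6 / 5 = u / (u - 1)\<close> for \<open>u = 6\<close> is what the constant allows; fewer than six cosets
  are handled with one cop per coset.\<close>

theorem few_cops:
  assumes "CARD('a) \<ge> 2"
  obtains k where "wins {0} T k" "real k \<le> directed_const * sqrt (real CARD('a)) + 2"
proof (rule wins_from_good[OF assms])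
  note c = directed_const_bounds
  fix \<mu> and h u N :: nat
  assume \<mu>: "0 < \<mu>" "\<mu> \<le> 1" and u: "2 \<le> u" "u \<le> N" "1 \<le> h"
    and n: "CARD('a) = N * h" and full: "u = N \<Longrightarrow> \<mu> = 1"
    and ratios: "6 \<le> u \<Longrightarrow> real u / \<mu> \<le> 6 / 5 * real N" "real h / \<mu> \<le> 6 / 5 * real CARD('a)"
    and exp: "\<And>D. D \<noteq> {} \<Longrightarrow> D \<noteq> UNIV \<Longrightarrow>
      \<mu> * (real CARD('a) - real (card D)) \<le> real (card (D + T)) - real (card D)"
    and wins: "\<And>k k'. good u k \<Longrightarrow> good h k' \<Longrightarrow> wins {0} T (max k (Suc k'))"
  have bound: "\<exists>k. good p k \<and> real k \<le> 1 + 2 / sqrt (exp 1) * sqrt (p / \<mu>)" for p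
    using good_bound[OF \<mu> exp good_self, of 1 0 p] by auto
  have "\<exists>k. good u k \<and> real k \<le> directed_const * sqrt N + 2"
  proof (cases "6 \<le> u")
    case True
    then show ?thesis
      using bound[of u] sqrt_le_directed_const[OF _ ratios(1)] by force
  next
    case False
    show ?thesis
    proof (cases "u = N")
      case True
      then have "good u 1" using exp full by (intro good_one_if_full) simp
      moreover have "real 1 \<le> directed_const * sqrt N + 2" using c by simp
      ultimately show ?thesis by blast
    next
      case neq: False
      have "real u - 2 \<le> directed_const * sqrt N"
      proof (rule power2_le_imp_le)
        \<comment> \<open>The inequality derived from these cases is tight at \<open>u = 5\<close>;
          the bound \<open>u + 1 \<le> N\<close> used after it holds as
          \<open>u \<noteq> N\<close>.\<close>
        have "u = 2 \<or> u = 3 \<or> u = 4 \<or> u = 5" using False u by linarith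
        then have "(real u - 2)\<^sup>2 \<le> 3 / 2 * (real u + 1)"
          by (auto simp: power2_eq_square)
        also have "\<dots> \<le> directed_const\<^sup>2 * real N" using c u neq by (intro mult_mono) auto
        finally show "(real u - 2)\<^sup>2 \<le> (directed_const * sqrt N)\<^sup>2"
          by (simp add: power_mult_distrib)
      qed (use c in auto)
      then show ?thesis using good_self[of u] by (intro exI[of _ u]) auto
    qed
  qed
  then obtain k where k: "good u k" "real k \<le> directed_const * sqrt N + 2" by blast
  have "directed_const * sqrt N \<le> directed_const * sqrt (real CARD('a))"
    using c u n by (intro mult_left_mono real_sqrt_le_mono) auto
  moreover obtain k' where k': "good h k'" "real k' \<le> 1 + 2 / sqrt (exp 1) * sqrt (h / \<mu>)"
    using bound by blast
  moreover have "2 / sqrt (exp 1) * sqrt (h / \<mu>) \<le> directed_const * sqrt (real CARD('a))"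
    using ratios(2) by (intro sqrt_le_directed_const) auto
  ultimately have "real (max k (Suc k')) \<le> directed_const * sqrt (real CARD('a)) + 2"
    using k by (auto simp: max_def)
  then show ?thesis using that wins[OF k(1) k'(1)] by blast
qed

end

section \<open>Symmetric sets of moves\<close>

locale symmetric_pursuit = pursuit +
  assumes uminus_in: "t \<in> T \<Longrightarrow> - t \<in> T"
begin

text \<open>If \<open>d \<in> E\<close> then \<open>d + a\<close> or \<open>d + b\<close> lies in the interior of \<open>E\<close>, whence
  \<open>d + a + b \<in> E\<close>: so \<open>E\<close> is periodic under all sums of two distinct elements of \<open>Q\<close>.\<close>

lemma two_exits:
  fixes E Q :: "'a set"
  defines "X \<equiv> {y. \<forall>t\<in>T. y + t \<in> E}"
  assumes step: "\<And>d a b. d \<in> E \<Longrightarrow> a \<in> Q \<Longrightarrow> b \<in> Q \<Longrightarrow> a \<noteq> b \<Longrightarrow> d + a \<in> X \<or> d + b \<in> X"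
    and Q: "Q \<subseteq> T" "3 \<le> card Q \<or> (0 \<in> Q \<and> Q \<noteq> {0})" and "E \<noteq> UNIV"
  shows "E = {}"
proof (rule ccontr)
  assume "E \<noteq> {}"
  have XE: "x \<in> E" if "x \<in> X" for x
    using that zero_in by (force simp: X_def)
  have shiftE: "d \<in> E \<longleftrightarrow> d + (a + b) \<in> E" if "a \<in> Q" "b \<in> Q" "a \<noteq> b" for a b d
  proof -
    note ab = that
    have "(\<lambda>d. d + (a + b)) ` E \<subseteq> E"
    proof (rule image_subsetI)
      fix d assume "d \<in> E"
      then consider "d + a \<in> X" | "d + b \<in> X" using step[OF _ ab] by blast
      then show "d + (a + b) \<in> E"
      proof cases
        case 1
        then have "d + a + b \<in> E" using ab Q by (auto simp: X_def)
        then show ?thesis by (simp add: add.assoc)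
      next
        case 2
        then have "d + b + a \<in> E" using ab Q by (auto simp: X_def)
        then show ?thesis by (simp add: ac_simps)
      qed
    qed
    then have eq: "(\<lambda>d. d + (a + b)) ` E = E"
      by (intro card_seteq) (auto simp: card_image)
    have "d + (a + b) \<in> (\<lambda>d. d + (a + b)) ` E \<longleftrightarrow> d \<in> E" by auto
    then show ?thesis unfolding eq by simp
  qed
  have shiftX: "d \<in> X \<longleftrightarrow> d + (a + b) \<in> X" if "a \<in> Q" "b \<in> Q" "a \<noteq> b" for a b d
  proof -
    have "d + t \<in> E \<longleftrightarrow> d + (a + b) + t \<in> E" for t
      using shiftE[OF that, of "d + t"] by (simp add: ac_simps)
    then show ?thesis by (simp add: X_def)
  qed
  have "E \<subseteq> X"
  proof
    fix d assume d: "d \<in> E"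
    from Q(2) consider a where "a \<in> Q" "0 \<in> Q" "a \<noteq> 0"
      | a b c where "a \<in> Q" "b \<in> Q" "c \<in> Q" "a \<noteq> b" "b \<noteq> c" "a \<noteq> c"
    proof (elim disjE)
      assume "3 \<le> card Q"
      then obtain Q' where "Q' \<subseteq> Q" "card Q' = 3"
        by (meson obtain_subset_with_card_n)
      then show ?thesis using that(2) by (auto simp: card_3_iff)
    qed (use that(1) in blast)
    then show "d \<in> X"
    proof cases
      case (1 a)
      \<comment> \<open>Here \<open>a = 0 + a\<close> is itself a period of \<open>X\<close>, so
        both alternatives of \<open>step\<close> give \<open>d \<in> X\<close>.\<close>
      then show ?thesis using step[OF d 1(2,1)] shiftX[of 0 a d] by auto
    next
      case (2 a b c)
      \<comment> \<open>A third move makes \<open>a - b = (a + c) - (b + c)\<close> a period of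
        \<open>X\<close>, so the choice between \<open>a\<close> and \<open>b\<close> in
        \<open>step\<close> is immaterial.\<close>
      have "e + a \<in> X" if "e \<in> E" for e
      proof (cases "e + a \<in> X")
        case False
        then have "e + b \<in> X" using step[OF that] 2 by blast
        moreover have "e - c + (b + c) = e + b" "e - c + (a + c) = e + a"
          by (simp_all add: algebra_simps)
        ultimately show ?thesis using shiftX[of b c "e - c"] shiftX[of a c "e - c"] 2 by simp
      qed
      \<comment> \<open>The double of \<open>a\<close> is
        \<open>(a + b) - (b + c) + (a + c)\<close>, a combination of periods, so \<open>d\<close>
        itself lies in \<open>X\<close>.\<close>
      then have "d + a + a \<in> X" using d XE by blast
      moreover have "d + a - b + (a + b) = d + a + a" "d + a - b + (b + c) = d + (a + c)"
        by (simp_all add: algebra_simps)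
      ultimately show ?thesis
        using shiftX[of a b "d + a - b"] shiftX[of b c "d + a - b"] shiftX[of a c d] 2
        by (simp add: add.assoc)
    qed
  qed
  then have "E + T \<subseteq> E" by (auto simp: X_def set_plus_def)
  then show False using generates \<open>E \<noteq> {}\<close> \<open>E \<noteq> UNIV\<close> by blast
qed

text \<open>If both \<open>a\<close> and \<open>b\<close> had answers leading from \<open>d\<close>
  to approachable differences, \<open>forced\<close> would apply to \<open>{a, b}\<close>. So for
  one \<open>x\<close> of the two all \<open>d + x - t\<close> are unapproachable, and by symmetry
  of \<open>T\<close> all \<open>d + x + t\<close>: this is what \<open>two_exits\<close> asks
  for.\<close>

lemma wins_pairs:
  assumes R: "R \<subseteq> T" "Q \<subseteq> R" "3 \<le> card Q \<or> (0 \<in> Q \<and> Q \<noteq> {0})" and Z: "Z \<noteq> {}"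
    and wins: "\<And>a b. a \<in> Q \<Longrightarrow> b \<in> Q \<Longrightarrow> a \<noteq> b \<Longrightarrow> wins Z (R - {a, b}) k"
  shows "wins Z R (Suc k)"
proof -
  define E where "E = {d. \<not> approachable Z R k d}"
  have "E = {}"
  proof (rule two_exits)
    fix d a b assume d: "d \<in> E" and ab: "a \<in> Q" "b \<in> Q" "a \<noteq> b"
    have "\<not> (\<forall>x\<in>{a, b}. \<exists>t\<in>T. approachable Z R k (d + x - t))"
    proof
      assume "\<forall>x\<in>{a, b}. \<exists>t\<in>T. approachable Z R k (d + x - t)"
      then have "approachable Z R k d"
        using ab R wins[OF ab] by (intro approachable.forced[of "{a, b}"]) auto
      then show False using d by (simp add: E_def)
    qed
    then obtain x where x: "x \<in> {a, b}" "\<And>t. t \<in> T \<Longrightarrow> d + x - t \<in> E"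
      by (auto simp: E_def)
    have "d + x + t \<in> E" if "t \<in> T" for t
      using x(2)[OF uminus_in[OF that]] by simp
    then show "d + a \<in> {y. \<forall>t\<in>T. y + t \<in> E} \<or> d + b \<in> {y. \<forall>t\<in>T. y + t \<in> E}"
      using x(1) by blast
  next
    show "E \<noteq> UNIV" using Z by (auto simp: E_def intro: approachable.target)
  qed (use R in auto)
  then show ?thesis using R by (intro approachable_imp_wins) (auto simp: E_def)
qed

text \<open>Each further cop takes care of two moves while at least three are left; the last two
  need at most one cop each.\<close>

lemma wins_half:
  assumes "R \<subseteq> T" "Z \<noteq> {}"
  shows "wins Z R (card R div 2 + 1)"
  using assms(1)
proof (induction "card R" arbitrary: R rule: less_induct)
  case less
  show ?case
  proof (cases "3 \<le> card R")
    case True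
    have "wins Z R (Suc (card R div 2))"
    proof (rule wins_pairs)
      fix a b assume ab: "a \<in> R" "b \<in> R" "a \<noteq> b"
      then have c: "card (R - {a, b}) = card R - 2" by (simp add: card_Diff_subset)
      then have "wins Z (R - {a, b}) (card (R - {a, b}) div 2 + 1)"
        using True less.prems by (intro less.hyps) auto
      then show "wins Z (R - {a, b}) (card R div 2)"
        by (rule wins_mono) (use c True in linarith)
    qed (use less.prems True assms in auto)
    then show ?thesis by simp
  next
    case False
    have "wins Z R (card R)" using less.prems assms by (intro goodD[OF good_self]) auto
    then show ?thesis by (rule wins_mono) (use False in linarith)
  qed
qed

lemma good_half: "good m (m div 2 + 1)"
  unfolding good_def
proof (intro allI impI)
  fix Z R :: "'a set" assume R: "Z \<noteq> {}" "R \<subseteq> T" "card R \<le> m"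
  have "wins Z R (card R div 2 + 1)" using R by (intro wins_half)
  then show "wins Z R (m div 2 + 1)" by (rule wins_mono) (simp add: R div_le_mono)
qed

text \<open>The move \<open>0\<close> saves a cop when \<open>card R\<close> is even: pairs are
  removed from \<open>R - {0}\<close>, and the final pair contains \<open>0\<close>, which
  \<open>wins_pairs\<close> admits without a third move.\<close>

lemma wins_even:
  assumes "R \<subseteq> T" "0 \<in> R" "card R \<le> 2 * k" "Z \<noteq> {}"
  shows "wins Z R k"
  using assms(1-3)
proof (induction k arbitrary: R)
  case 0
  then have "R = {}" by simp
  then show ?case using 0 by simp
next
  case (Suc k)
  consider "4 \<le> card R" | "card R = 3" | "card R = 2" | "card R \<le> 1" by linarith
  then show ?case
  proof cases
    case 1
    show ?thesis
    proof (rule wins_pairs[of R "R - {0}"])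
      fix a b assume "a \<in> R - {0}" "b \<in> R - {0}" "a \<noteq> b"
      then show "wins Z (R - {a, b}) k"
        using Suc.prems by (intro Suc.IH) (auto simp: card_Diff_subset)
    qed (use Suc.prems 1 assms in \<open>auto simp: card_Diff_subset\<close>)
  next
    case 2
    have "wins Z R (card R div 2 + 1)" using Suc.prems assms by (intro wins_half)
    then show ?thesis by (rule wins_mono) (use 2 Suc.prems in simp)
  next
    case 3
    show ?thesis
    proof (rule wins_pairs[of R R])
      fix a b assume "a \<in> R" "b \<in> R" "a \<noteq> b"
      then have "card (R - {a, b}) = 0" using 3 by (simp add: card_Diff_subset)
      then have "R - {a, b} = {}" by simp
      then show "wins Z (R - {a, b}) k" by (simp only: wins_empty)
    qed (use Suc.prems 3 assms in auto)
  next
    case 4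
    have "wins Z R 1" using Suc.prems assms 4 by (intro goodD[OF good_self]) auto
    then show ?thesis by (rule wins_mono) simp
  qed
qed

text \<open>The argument of \<open>few_cops\<close> with \<open>good_half\<close> for
  \<open>good_self\<close>: the slope \<open>1 / 2\<close> under the root gives the divisor
  \<open>sqrt 2\<close>, and the additive term becomes \<open>2\<close>, or \<open>3\<close> for
  \<open>Suc k'\<close>. For \<open>u < 6\<close> three cops suffice against \<open>u\<close>
  moves.\<close>

theorem few_cops_symmetric:
  assumes "CARD('a) \<ge> 2"
  obtains k where "wins {0} T k"
    "real k \<le> directed_const / sqrt 2 * sqrt (real CARD('a)) + 7 / 2"
proof (rule wins_from_good[OF assms])
  note c = directed_const_bounds
  fix \<mu> and h u N :: nat
  assume \<mu>: "0 < \<mu>" "\<mu> \<le> 1" and u: "2 \<le> u" "u \<le> N" "1 \<le> h"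
    and n: "CARD('a) = N * h" and full: "u = N \<Longrightarrow> \<mu> = 1"
    and ratios: "6 \<le> u \<Longrightarrow> real u / \<mu> \<le> 6 / 5 * real N" "real h / \<mu> \<le> 6 / 5 * real CARD('a)"
    and exp: "\<And>D. D \<noteq> {} \<Longrightarrow> D \<noteq> UNIV \<Longrightarrow>
      \<mu> * (real CARD('a) - real (card D)) \<le> real (card (D + T)) - real (card D)"
    and wins: "\<And>k k'. good u k \<Longrightarrow> good h k' \<Longrightarrow> wins {0} T (max k (Suc k'))"
  have bound: "\<exists>k. good p k \<and> real k \<le> 2 + directed_const / sqrt 2 * sqrt y"
    if "real p / \<mu> \<le> 6 / 5 * y" "0 \<le> y" for p y
  proof -
    have half: "real (m div 2 + 1) \<le> 1 / 2 * real m + 1" for m by simp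
    obtain k where k: "good p k" "real k \<le> 1 + 2 / sqrt (exp 1) * sqrt (1 / 2 * p / \<mu>) + 1"
      using good_bound[OF \<mu> exp good_half half] by auto
    have "sqrt (1 / 2 * p / \<mu>) = sqrt (p / \<mu>) / sqrt 2"
      by (simp add: real_sqrt_divide real_sqrt_mult)
    then have "2 / sqrt (exp 1) * sqrt (1 / 2 * p / \<mu>) = 2 / sqrt (exp 1) * sqrt (p / \<mu>) / sqrt 2"
      by simp
    also have "\<dots> \<le> directed_const * sqrt y / sqrt 2"
      using that by (intro divide_right_mono sqrt_le_directed_const) auto
    finally show ?thesis using k by (intro exI[of _ k]) auto
  qed
  have "\<exists>k. good u k \<and> real k \<le> directed_const / sqrt 2 * sqrt N + 7 / 2"
  proof (cases "6 \<le> u")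
    case True
    then show ?thesis using bound[OF ratios(1)] by force
  next
    case False
    have "0 \<le> directed_const / sqrt 2 * sqrt N" using c by simp
    moreover have "u div 2 + 1 \<le> 3" using False by simp
    ultimately show ?thesis using good_half[of u] by (intro exI[of _ "u div 2 + 1"]) auto
  qed
  then obtain k where k: "good u k" "real k \<le> directed_const / sqrt 2 * sqrt N + 7 / 2" by blast
  have "directed_const / sqrt 2 * sqrt N \<le> directed_const / sqrt 2 * sqrt (real CARD('a))"
    using c u n by (intro mult_left_mono real_sqrt_le_mono) auto
  moreover obtain k' where k': "good h k'"
    "real k' \<le> 2 + directed_const / sqrt 2 * sqrt (real CARD('a))"
    using bound[OF ratios(2)] by auto
  ultimately have "real (max k (Suc k')) \<le> directed_const / sqrt 2 * sqrt (real CARD('a)) + 7 / 2"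
    using k by (auto simp: max_def)
  then show ?thesis using that wins[OF k(1) k'(1)] by blast
qed

end

section \<open>The game on Cayley digraphs\<close>

primrec sums_upto :: "'a::comm_monoid_add set \<Rightarrow> nat \<Rightarrow> 'a set" where
  "sums_upto S 0 = {0}"
| "sums_upto S (Suc s) = sums_upto S s \<union> (sums_upto S s + S)"

lemma zero_in_sums_upto: "0 \<in> sums_upto S s"
  by (induction s) auto

lemma sums_upto_add: "w \<in> sums_upto S s \<Longrightarrow> g \<in> S \<Longrightarrow> w + g \<in> sums_upto S (Suc s)"
  by (auto simp: set_plus_def)

lemma sums_upto_SucE:
  assumes "y \<in> sums_upto S (Suc s)"
  obtains "y \<in> sums_upto S s" | w g where "w \<in> sums_upto S s" "g \<in> S" "y = w + g"
  using assms by (auto simp: set_plus_def)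

lemma subset_sums_upto:
  assumes "1 \<le> s"
  shows "S \<subseteq> sums_upto S s"
proof
  fix g assume "g \<in> S"
  then show "g \<in> sums_upto S s"
    using sums_upto_add[OF zero_in_sums_upto, of g S "s - 1"] assms by simp
qed

lemma uminus_in_sums_upto:
  fixes S :: "'a::ab_group_add set"
  assumes "S = uminus ` S" "w \<in> sums_upto S s"
  shows "- w \<in> sums_upto S s"
  using assms(2)
proof (induction s arbitrary: w)
  case (Suc s)
  show ?case
  proof (cases "w \<in> sums_upto S s")
    case False
    then obtain v g where vg: "v \<in> sums_upto S s" "g \<in> S" "w = v + g"
      using Suc.prems by (auto simp: set_plus_def)
    have "- g \<in> S" using vg(2) assms(1) by blast
    then have "- v + - g \<in> sums_upto S (Suc s)" using Suc.IH[OF vg(1)] by (rule sums_upto_add[rotated])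
    then show ?thesis using vg by (simp add: algebra_simps)
  qed (use Suc.IH in simp)
qed simp

text \<open>Either \<open>a\<close> does not occur in the sum, or one copy of it splits off; these
  are the two terms of Pascal's rule.\<close>

lemma sums_upto_insert:
  "sums_upto (insert a S) (Suc s) \<subseteq> sums_upto S (Suc s) \<union> (+) a ` sums_upto (insert a S) s"
proof (induction s)
  case 0
  show ?case by (auto simp: set_plus_def)
next
  case (Suc s)
  show ?case
  proof
    fix y assume "y \<in> sums_upto (insert a S) (Suc (Suc s))"
    then consider "y \<in> sums_upto (insert a S) (Suc s)"
      | w g where "w \<in> sums_upto (insert a S) (Suc s)" "g \<in> insert a S" "y = w + g"
      by (rule sums_upto_SucE)
    then show "y \<in> sums_upto S (Suc (Suc s)) \<union> (+) a ` sums_upto (insert a S) (Suc s)"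
    proof cases
      case 1
      then show ?thesis using Suc.IH by auto
    next
      case (2 w g)
      show ?thesis
      proof (cases "g = a")
        case True
        then show ?thesis using 2 by (auto simp: add.commute simp del: sums_upto.simps)
      next
        case False
        then have g: "g \<in> S" using 2 by simp
        from 2(1) Suc.IH consider "w \<in> sums_upto S (Suc s)"
          | v where "v \<in> sums_upto (insert a S) s" "w = a + v" by blast
        then show ?thesis
        proof cases
          case 1
          then show ?thesis using sums_upto_add[OF _ g] 2 by blast
        next
          case (2 v)
          then have "v + g \<in> sums_upto (insert a S) (Suc s)"
            using g by (intro sums_upto_add) auto
          moreover have "y = a + (v + g)" using 2 \<open>y = w + g\<close> by (simp add: add.assoc)
          ultimately show ?thesis by blast
        qed
      qed
    qed
  qed
qed

text \<open>Double induction along Pascal's rule; the bound is the number of multisets of size at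
  most \<open>s\<close> from \<open>card S\<close> elements.\<close>

lemma card_sums_upto:
  fixes S :: "'a::{ab_group_add, finite} set"
  shows "card (sums_upto S s) \<le> (card S + s) choose s"
proof -
  have "finite S" by simp
  then show ?thesis
  proof (induction S arbitrary: s rule: finite_induct)
    case empty
    have "sums_upto ({} :: 'a set) s = {0}" by (induction s) (auto simp: set_plus_def)
    then show ?case by simp
  next
    case (insert a S)
    note IH = insert.IH
    show ?case
    proof (induction s)
      case (Suc s)
      have "card (sums_upto (insert a S) (Suc s))
          \<le> card (sums_upto S (Suc s) \<union> (+) a ` sums_upto (insert a S) s)"
        by (intro card_mono sums_upto_insert) simp
      also have "\<dots> \<le> card (sums_upto S (Suc s)) + card ((+) a ` sums_upto (insert a S) s)"
        by (rule card_Un_le)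
      also have "card ((+) a ` sums_upto (insert a S) s) = card (sums_upto (insert a S) s)"
        by (rule card_set_plus_translate)
      also have "card (sums_upto S (Suc s)) + card (sums_upto (insert a S) s)
          \<le> ((card S + Suc s) choose Suc s) + ((card (insert a S) + s) choose s)"
        by (intro add_mono IH Suc.IH)
      also have "\<dots> = (card (insert a S) + Suc s) choose Suc s"
        using insert.hyps by simp
      finally show ?case .
    qed simp
  qed
qed

section \<open>Walks, distances and moves as sums of generators\<close>

lemma length_vwalk_to_vpath: "length (vwalk_to_vpath p) \<le> length p"
proof (induction p rule: vwalk_to_vpath.induct)
  case (2 x xs)
  then show ?case
    using length_dropWhile_le[of "\<lambda>y. y \<noteq> x" xs] by fastforce
qed simp

context
  fixes S :: "'a::{ab_group_add, finite} set"
begin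

interpretation wf_digraph "with_proj (cayley S)"
  by (rule wf_digraph_cayley)

lemma cayley_simps: "pverts (cayley S) = UNIV"
  "(x, y) \<in> parcs (cayley S) \<longleftrightarrow> y - x \<in> S"
  by (auto simp: cayley_def intro!: exI[of _ "y - x"])

lemma awalk_imp_sums_upto: "awalk x p y \<Longrightarrow> y - x \<in> sums_upto S (length p)"
proof (induction p arbitrary: x)
  case (Cons e p)
  then have "fst e = x" "snd e - fst e \<in> S" "awalk (snd e) p y"
    using cayley_simps(2)[of "fst e" "snd e"] by (auto simp: awalk_Cons_iff)
  moreover have "y - x = (y - snd e) + (snd e - x)" by simp
  ultimately show ?case
    using Cons.IH[of "snd e"] sums_upto_add[of "y - snd e" S "length p" "snd e - x"] by simp
qed (simp add: awalk_Nil_iff)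

lemma sums_upto_imp_awalk:
  "y - x \<in> sums_upto S s \<Longrightarrow> \<exists>p. awalk x p y \<and> length p \<le> s"
proof (induction s arbitrary: x)
  case 0
  then show ?case by (intro exI[of _ "[]"]) (simp add: awalk_Nil_iff cayley_simps)
next
  case (Suc s)
  show ?case
  proof (cases "y - x \<in> sums_upto S s")
    case True
    then show ?thesis using Suc.IH le_SucI by blast
  next
    case False
    then obtain w g where wg: "w \<in> sums_upto S s" "g \<in> S" "y - x = w + g"
      using Suc.prems by (auto simp: set_plus_def)
    then have "y - (x + g) \<in> sums_upto S s" by (simp add: algebra_simps)
    then obtain p where p: "awalk (x + g) p y" "length p \<le> s" using Suc.IH by blast
    have "awalk x ((x, x + g) # p) y"
      using p wg by (simp add: awalk_Cons_iff cayley_simps)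
    then show ?thesis using p by (intro exI[of _ "(x, x + g) # p"]) simp
  qed
qed

lemma vwalk_imp_sums_upto:
  "vwalk p (with_proj (cayley S)) \<Longrightarrow> last p - hd p \<in> sums_upto S (length p - 1)"
proof (induction rule: vwalk_induct)
  case (Cons u v es)
  then have "(last (v # es) - v) + (v - u) \<in> sums_upto S (Suc (length es))"
    by (intro sums_upto_add) (auto simp: cayley_simps)
  then show ?case by simp
qed simp

lemma sums_upto_mono: "s \<le> s' \<Longrightarrow> sums_upto S s \<subseteq> sums_upto S s'"
  by (induction s' rule: dec_induct) auto

text \<open>A walk shortens to a path with the same ends, so the ban on repeated vertices does not
  restrict where a cop can go.\<close>

lemma travels_cayley_iff:
  "(\<exists>p. travels (with_proj (cayley S)) s x p y) \<longleftrightarrow> y - x \<in> sums_upto S s"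
proof
  assume "\<exists>p. travels (with_proj (cayley S)) s x p y"
  then obtain p where "vwalk p (with_proj (cayley S))" "length p - 1 \<le> s" "hd p = x" "last p = y"
    by (auto simp: travels_def vpath_def)
  then show "y - x \<in> sums_upto S s"
    using vwalk_imp_sums_upto[of p] sums_upto_mono by blast
next
  assume "y - x \<in> sums_upto S s"
  then obtain p where p: "awalk x p y" "length p \<le> s" using sums_upto_imp_awalk by blast
  let ?q = "awalk_verts x p"
  have q: "vwalk ?q (with_proj (cayley S))" "hd ?q = x" "last ?q = y" "length ?q = Suc (length p)"
    using p by (auto simp: awalk_imp_vwalk length_awalk_verts)
  then have "?q \<noteq> []" by auto
  then have "travels (with_proj (cayley S)) s x (vwalk_to_vpath ?q) y"
    using q p(2) length_vwalk_to_vpath[of ?q]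
    by (auto simp: travels_def vwalk_to_vpath_vpath vwalk_to_vpath_hd vwalk_to_vpath_last)
  then show "\<exists>p. travels (with_proj (cayley S)) s x p y" by blast
qed

lemma power_arc_iff:
  "(x, y) \<in> parcs (power_digraph (with_proj (cayley S)) s) \<longleftrightarrow> x \<noteq> y \<and> y - x \<in> sums_upto S s"
proof -
  have cost: "awalk_cost (\<lambda>_. 1) p = real (length p)" for p
    by (induction p) auto
  have "\<mu> (\<lambda>_. 1) x y \<le> ereal (real s) \<longleftrightarrow> y - x \<in> sums_upto S s"
  proof
    assume "y - x \<in> sums_upto S s"
    then obtain p where "awalk x p y" "length p \<le> s" using sums_upto_imp_awalk by blast
    then show "\<mu> (\<lambda>_. 1) x y \<le> ereal (real s)"
      using min_cost_le_walk_cost[of x p y "\<lambda>_. 1"] by (simp add: cost order.trans)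
  next
    assume le: "\<mu> (\<lambda>_. 1) x y \<le> ereal (real s)"
    show "y - x \<in> sums_upto S s"
    proof (rule ccontr)
      assume not: "y - x \<notin> sums_upto S s"
      \<comment> \<open>A strict bound on each walk would not survive the infimum; integrality of
        lengths raises it to \<open>Suc s\<close>.\<close>
      have "ereal (real (Suc s)) \<le> \<mu> (\<lambda>_. 1) x y"
        unfolding \<mu>_def
      proof (rule INF_greatest)
        fix p assume "p \<in> {p. awalk x p y}"
        then have "y - x \<in> sums_upto S (length p)" using awalk_imp_sums_upto by simp
        then have "s < length p" using not sums_upto_mono[of "length p" s] by (meson not_le subsetD)
        then show "ereal (real (Suc s)) \<le> ereal (awalk_cost (\<lambda>_. 1) p)" by (simp add: cost)
      qed
      then show False using le by (meson ereal_less_eq(3) lessI not_le of_nat_le_iff order.trans)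
    qed
  qed
  then show ?thesis by (auto simp: power_digraph_def cayley_simps)
qed

lemma verts_power: "pverts (power_digraph (with_proj (cayley S)) s) = UNIV"
  by (simp add: power_digraph_def cayley_def)

lemma robber_move_power_iff:
  "robber_move (with_proj (power_digraph (with_proj (cayley S)) s)) 1 C x y \<longleftrightarrow>
    y - x \<in> sums_upto S s \<and> x \<notin> set C \<and> y \<notin> set C"
proof
  assume "robber_move (with_proj (power_digraph (with_proj (cayley S)) s)) 1 C x y"
  then obtain p where p: "vwalk p (with_proj (power_digraph (with_proj (cayley S)) s))"
    "length p - 1 \<le> 1" "hd p = x" "last p = y" "set p \<inter> set C = {}"
    by (auto simp: robber_move_def travels_def vpath_def)
  then consider "p = [x]" "x = y" | "p = [x, y]"
    by (cases p rule: remdups_adj.cases) (auto simp: vwalk_def)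
  then show "y - x \<in> sums_upto S s \<and> x \<notin> set C \<and> y \<notin> set C"
    using p by cases (auto simp: zero_in_sums_upto vwalk_def power_arc_iff)
next
  assume *: "y - x \<in> sums_upto S s \<and> x \<notin> set C \<and> y \<notin> set C"
  have "travels (with_proj (power_digraph (with_proj (cayley S)) s)) 1 x
      (if x = y then [x] else [x, y]) y"
    using * by (auto simp: travels_def vpath_def vwalk_def verts_power power_arc_iff)
  then show "robber_move (with_proj (power_digraph (with_proj (cayley S)) s)) 1 C x y"
    using * unfolding robber_move_def by (intro exI conjI) (assumption, auto)
qed

lemma travels_power_iff:
  "(\<exists>p. travels (with_proj (power_digraph (with_proj (cayley S)) s)) 1 x p y) \<longleftrightarrow>
    y - x \<in> sums_upto S s"
  using robber_move_power_iff[of s "[]"] by (simp add: robber_move_def)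

lemma cop_strategy_iff:
  "cop_strategy (with_proj (cayley S)) s k \<sigma> \<longleftrightarrow> length (\<sigma> []) = k \<and>
    (\<forall>h x. list_all2 (\<lambda>u v. v - u \<in> sums_upto S s) (\<sigma> h) (\<sigma> (h @ [x])))"
  "cop_strategy (with_proj (power_digraph (with_proj (cayley S)) s)) 1 k \<sigma> \<longleftrightarrow> length (\<sigma> []) = k \<and>
    (\<forall>h x. list_all2 (\<lambda>u v. v - u \<in> sums_upto S s) (\<sigma> h) (\<sigma> (h @ [x])))"
  unfolding cop_strategy_def cops_move_def travels_cayley_iff travels_power_iff
    with_proj_simps verts_power cayley_simps by simp_all

section \<open>Equivalence of the game at speed \<open>s\<close> with the ordinary game on the
  power\<close>

lemma robber_move_cayley_imp:
  assumes "robber_move (with_proj (cayley S)) s C x y"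
  shows "robber_move (with_proj (power_digraph (with_proj (cayley S)) s)) 1 C x y"
proof -
  from assms obtain p where p: "travels (with_proj (cayley S)) s x p y" "set p \<inter> set C = {}"
    by (auto simp: robber_move_def)
  then have "y - x \<in> sums_upto S s" using travels_cayley_iff by blast
  moreover have "x \<in> set p" "y \<in> set p"
    using p(1) by (auto simp: travels_def vpath_def vwalk_def)
  ultimately show ?thesis using p(2) unfolding robber_move_power_iff by blast
qed

text \<open>A cop standing at \<open>c\<close> on the robber's path can itself run along the rest of
  that path to \<open>y\<close>.\<close>

lemma blocked_robber_reachable:
  assumes "y - x \<in> sums_upto S s" "\<not> robber_move (with_proj (cayley S)) s C x y"
  obtains c where "c \<in> set C" "y - c \<in> sums_upto S s"
proof -
  obtain p where p: "travels (with_proj (cayley S)) s x p y"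
    using assms(1) travels_cayley_iff by blast
  then obtain c where c: "c \<in> set p" "c \<in> set C"
    using assms(2) by (auto simp: robber_move_def)
  then obtain p1 p2 where split: "p = p1 @ c # p2" by (meson split_list)
  have "vwalk (c # p2) (with_proj (cayley S))" "length p \<le> Suc s" "last (c # p2) = y"
    using p split by (auto simp: travels_def vpath_def intro: vwalkI_append_r)
  then have "y - c \<in> sums_upto S (length p2)" "length p2 \<le> s"
    using vwalk_imp_sums_upto[of "c # p2"] split by auto
  then show ?thesis using that c sums_upto_mono by blast
qed

text \<open>The history is listed with the latest robber position first.  The flag records that some cop
  has already jumped onto the robber.\<close>

fun pounce :: "('a list \<Rightarrow> 'a list) \<Rightarrow> nat \<Rightarrow> 'a list \<Rightarrow> bool \<times> 'a list" where
  "pounce \<sigma> s [] = (False, \<sigma> [])"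
| "pounce \<sigma> s (x # h) = (let (b, C) = pounce \<sigma> s h in
    if b then (b, C)
    else if \<exists>i<length C. x - C ! i \<in> sums_upto S s
      then (True, C[(SOME i. i < length C \<and> x - C ! i \<in> sums_upto S s) := x])
    else (False, \<sigma> (rev (x # h))))"

lemma pounce_False: "\<not> fst (pounce \<sigma> s h) \<Longrightarrow> snd (pounce \<sigma> s h) = \<sigma> (rev h)"
  by (cases h) (auto simp: Let_def split: prod.splits if_splits)

lemma pounce_captures:
  assumes "\<not> fst (pounce \<sigma> s h)" "fst (pounce \<sigma> s (x # h))"
  shows "x \<in> set (snd (pounce \<sigma> s (x # h)))"
proof -
  obtain C where C: "pounce \<sigma> s h = (False, C)" using assms(1) by (cases "pounce \<sigma> s h") auto
  let ?P = "\<lambda>i. i < length C \<and> x - C ! i \<in> sums_upto S s"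
  have ex: "\<exists>i. ?P i" using assms(2) C by (auto split: if_splits)
  then have "?P (SOME i. ?P i)" by (rule someI_ex)
  then show ?thesis using C ex by (auto intro: set_update_memI)
qed

lemma pounce_legal:
  assumes "\<And>h x. list_all2 (\<lambda>u v. v - u \<in> sums_upto S s) (\<sigma> h) (\<sigma> (h @ [x]))"
  shows "list_all2 (\<lambda>u v. v - u \<in> sums_upto S s) (snd (pounce \<sigma> s h)) (snd (pounce \<sigma> s (x # h)))"
proof -
  obtain b C where C: "pounce \<sigma> s h = (b, C)" by fastforce
  let ?P = "\<lambda>i. i < length C \<and> x - C ! i \<in> sums_upto S s"
  consider "b" | "\<not> b" "\<exists>i. ?P i" | "\<not> b" "\<nexists>i. ?P i" by blast
  then show ?thesis
  proof cases
    case 1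
    then show ?thesis using C by (simp add: list_all2_same zero_in_sums_upto)
  next
    case 2
    have "?P (SOME i. ?P i)" using 2(2) by (rule someI_ex)
    then show ?thesis
      using C 2 by (auto simp: list_all2_conv_all_nth nth_list_update zero_in_sums_upto)
  next
    case 3
    then show ?thesis using C assms[of "rev h" x] pounce_False[of \<sigma> s h] by auto
  qed
qed

text \<open>From the power to the original game the same strategy works, as every robber move there
  is a move in the power. Conversely the cops follow \<open>\<sigma>\<close> but pounce when they
  can: a robber whose paths are all blocked and who jumps nevertheless is in reach of a cop and
  caught at once, so until capture all moves are legal at speed \<open>s\<close>.\<close>

lemma cops_guarantee_capture_power_iff:
  "cops_guarantee_capture (with_proj (power_digraph (with_proj (cayley S)) s)) 1 1 k \<longleftrightarrow>
    cops_guarantee_capture (with_proj (cayley S)) s s k"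
proof
  assume "cops_guarantee_capture (with_proj (power_digraph (with_proj (cayley S)) s)) 1 1 k"
  then obtain \<sigma> where \<sigma>: "cop_strategy (with_proj (power_digraph (with_proj (cayley S)) s)) 1 k \<sigma>"
    and win: "\<And>\<rho>. robber_play (with_proj (power_digraph (with_proj (cayley S)) s)) 1 \<sigma> \<rho> \<Longrightarrow>
      \<exists>t. captured_at \<sigma> \<rho> t"
    unfolding cops_guarantee_capture_def by blast
  have "cop_strategy (with_proj (cayley S)) s k \<sigma>" using \<sigma> unfolding cop_strategy_iff .
  moreover have "\<exists>t. captured_at \<sigma> \<rho> t" if "robber_play (with_proj (cayley S)) s \<sigma> \<rho>" for \<rho>
  proof (rule win)
    show "robber_play (with_proj (power_digraph (with_proj (cayley S)) s)) 1 \<sigma> \<rho>"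
      using that robber_move_cayley_imp unfolding robber_play_def with_proj_simps verts_power by blast
  qed
  ultimately show "cops_guarantee_capture (with_proj (cayley S)) s s k"
    unfolding cops_guarantee_capture_def by blast
next
  assume "cops_guarantee_capture (with_proj (cayley S)) s s k"
  then obtain \<sigma> where \<sigma>: "cop_strategy (with_proj (cayley S)) s k \<sigma>"
    and win: "\<And>\<rho>. robber_play (with_proj (cayley S)) s \<sigma> \<rho> \<Longrightarrow> \<exists>t. captured_at \<sigma> \<rho> t"
    unfolding cops_guarantee_capture_def by blast
  define \<tau> where "\<tau> h = snd (pounce \<sigma> s (rev h))" for h
  have "cop_strategy (with_proj (power_digraph (with_proj (cayley S)) s)) 1 k \<tau>"
    using \<sigma> pounce_legal[of s \<sigma>] unfolding cop_strategy_iff \<tau>_def by simp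
  moreover have "\<exists>t. captured_at \<tau> \<rho> t"
    if play: "robber_play (with_proj (power_digraph (with_proj (cayley S)) s)) 1 \<tau> \<rho>" for \<rho>
  proof (rule ccontr)
    assume "\<nexists>t. captured_at \<tau> \<rho> t"
    then have free: "\<rho> t \<notin> set (cops_at \<tau> \<rho> (Suc t))" "\<not> captured_at \<tau> \<rho> t" for t
      by (auto simp: captured_at_def)
    have False_at: "\<not> fst (pounce \<sigma> s (rev (map \<rho> [0..<t])))" for t
    proof (induction t)
      case (Suc t)
      have "rev (map \<rho> [0..<Suc t]) = \<rho> t # rev (map \<rho> [0..<t])" by simp
      then show ?case
        using pounce_captures[OF Suc, of "\<rho> t"] free(1)[of t] unfolding cops_at_def \<tau>_def by metis
    qed simp
    have same: "cops_at \<tau> \<rho> t = cops_at \<sigma> \<rho> t" for t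
      using pounce_False[OF False_at[of t]] by (simp add: cops_at_def \<tau>_def)
    have "robber_move (with_proj (cayley S)) s (cops_at \<sigma> \<rho> (Suc t)) (\<rho> t) (\<rho> (Suc t))" for t
    proof (rule ccontr)
      assume not: "\<not> ?thesis"
      have "\<rho> (Suc t) - \<rho> t \<in> sums_upto S s"
        using play free(2) unfolding robber_play_def robber_move_power_iff by blast
      then obtain c where c: "c \<in> set (cops_at \<sigma> \<rho> (Suc t))" "\<rho> (Suc t) - c \<in> sums_upto S s"
        using not by (rule blocked_robber_reachable)
      let ?h = "rev (map \<rho> [0..<Suc t])"
      have h: "rev (map \<rho> [0..<Suc (Suc t)]) = \<rho> (Suc t) # ?h" by simp
      have "pounce \<sigma> s ?h = (False, cops_at \<sigma> \<rho> (Suc t))"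
        using False_at[of "Suc t"] pounce_False[OF False_at[of "Suc t"]]
        by (simp add: cops_at_def prod_eq_iff)
      moreover have "\<exists>i<length (cops_at \<sigma> \<rho> (Suc t)). \<rho> (Suc t) - cops_at \<sigma> \<rho> (Suc t) ! i \<in> sums_upto S s"
        using c by (metis in_set_conv_nth)
      ultimately have "fst (pounce \<sigma> s (\<rho> (Suc t) # ?h))" by simp
      then show False using False_at[of "Suc (Suc t)"] h by simp
    qed
    then have "robber_play (with_proj (cayley S)) s \<sigma> \<rho>"
      by (simp add: robber_play_def cayley_simps)
    then obtain t where "captured_at \<sigma> \<rho> t" using win by blast
    then have "captured_at \<tau> \<rho> t" by (simp add: captured_at_def same)
    then show False using free(2) by blast
  qed
  ultimately show "cops_guarantee_capture (with_proj (power_digraph (with_proj (cayley S)) s)) 1 1 k"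
    unfolding cops_guarantee_capture_def by blast
qed

lemma pursuit_sums_upto:
  assumes "strongly_connected (with_proj (cayley S))" "1 \<le> s"
  shows "pursuit (sums_upto S s)"
proof
  show "0 \<in> sums_upto S s" by (rule zero_in_sums_upto)
  fix D :: "'a set" assume D: "D \<noteq> {}" "D + sums_upto S s \<subseteq> D"
  have step: "d + g \<in> D" if "d \<in> D" "g \<in> S" for d g
    using D(2) subset_sums_upto[OF assms(2)] that by (blast intro: set_plus_intro)
  have closed: "d + w \<in> D" if "d \<in> D" "w \<in> sums_upto S n" for d w n
    using that
  proof (induction n arbitrary: w)
    case (Suc n)
    show ?case
    proof (cases "w \<in> sums_upto S n")
      case False
      then obtain v g where "v \<in> sums_upto S n" "g \<in> S" "w = v + g"
        using Suc.prems by (auto simp: set_plus_def)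
      then show ?thesis using step[of "d + v" g] Suc.IH[of v] that(1) by (simp add: add.assoc)
    qed (use Suc in simp)
  qed simp
  obtain d where d: "d \<in> D" using D(1) by blast
  have "v \<in> D" for v
  proof -
    have "d \<rightarrow>\<^sup>*\<^bsub>with_proj (cayley S)\<^esub> v"
      using assms(1) by (auto simp: strongly_connected_def cayley_simps)
    then obtain p where "awalk d p v" using reachable_awalk by blast
    then have "v - d \<in> sums_upto S (length p)" by (rule awalk_imp_sums_upto)
    from closed[OF d this] show ?thesis by simp
  qed
  then show "D = UNIV" by blast
qed

end

section \<open>From winning positions to strategies\<close>

context pursuit
begin

text \<open>The robber stands at \<open>y\<close> and is to move, so histories given to
  \<open>\<tau>\<close> begin with its position after its first move. By induction each first move
  \<open>r\<close> has its own strategy for the rest, and the first entry of the history selects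
  it.\<close>

lemma strategy_from_Win:
  assumes "Win {0} T {..<k} \<delta>"
  shows "\<exists>\<tau>. \<tau> [] = map (\<lambda>i. y - \<delta> i) [0..<k] \<and>
    (\<forall>h x. list_all2 (\<lambda>u v. v - u \<in> T) (\<tau> h) (\<tau> (h @ [x]))) \<and>
    (\<forall>\<rho>. \<rho> 0 = y \<longrightarrow> (\<forall>t. \<rho> (Suc t) - \<rho> t \<in> T) \<longrightarrow> (\<exists>t. \<rho> t \<in> set (\<tau> (map \<rho> [1..<Suc t]))))"
  using assms
proof (induction arbitrary: y)
  case (hit i \<delta>)
  have "y \<in> set (map (\<lambda>i. y - \<delta> i) [0..<k])" using hit by force
  then show ?case
    using zero_in by (intro exI[of _ "\<lambda>_. map (\<lambda>i. y - \<delta> i) [0..<k]"]) (auto simp: list_all2_same)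
next
  case (move \<delta>)
  define good where "good r \<delta>' \<tau> \<longleftrightarrow> (\<forall>i\<in>{..<k}. \<delta> i + r - \<delta>' i \<in> T) \<and>
    \<tau> [] = map (\<lambda>i. y + r - \<delta>' i) [0..<k] \<and>
    (\<forall>h x. list_all2 (\<lambda>u v. v - u \<in> T) (\<tau> h) (\<tau> (h @ [x]))) \<and>
    (\<forall>\<rho>. \<rho> 0 = y + r \<longrightarrow> (\<forall>t. \<rho> (Suc t) - \<rho> t \<in> T) \<longrightarrow> (\<exists>t. \<rho> t \<in> set (\<tau> (map \<rho> [1..<Suc t]))))"
    for r \<delta>' and \<tau> :: "'a list \<Rightarrow> 'a list"
  have "\<forall>r. \<exists>\<delta>' \<tau>. r \<in> T \<longrightarrow> good r \<delta>' \<tau>"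
    using move.IH unfolding good_def by blast
  then obtain \<delta>' \<tau>' where g: "\<And>r. r \<in> T \<Longrightarrow> good r (\<delta>' r) (\<tau>' r)" by metis
  define C where "C = map (\<lambda>i. y - \<delta> i) [0..<k]"
  \<comment> \<open>The value \<open>C\<close> after a first move outside \<open>T\<close> only
    makes \<open>\<tau>\<close> total and legal.\<close>
  define \<tau> where "\<tau> h = (case h of [] \<Rightarrow> C | x # h' \<Rightarrow> if x - y \<in> T then \<tau>' (x - y) h' else C)" for h
  have stay: "list_all2 (\<lambda>u v. v - u \<in> T) C C" using zero_in by (simp add: list_all2_same)
  have "list_all2 (\<lambda>u v. v - u \<in> T) (\<tau> h) (\<tau> (h @ [x]))" for h x
  proof (cases h)
    case Nil
    show ?thesis
    proof (cases "x - y \<in> T")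
      case True
      then have "\<tau> (h @ [x]) = map (\<lambda>i. y + (x - y) - \<delta>' (x - y) i) [0..<k]"
        using g[OF True] Nil by (simp add: good_def \<tau>_def)
      moreover have "y + (x - y) - \<delta>' (x - y) i - (y - \<delta> i) \<in> T" if "i < k" for i
      proof -
        have "\<delta> i + (x - y) - \<delta>' (x - y) i \<in> T" using g[OF True] that by (simp add: good_def)
        then show ?thesis by (simp add: algebra_simps)
      qed
      ultimately show ?thesis
        using Nil by (simp add: \<tau>_def C_def list_all2_conv_all_nth)
    qed (use Nil stay in \<open>simp add: \<tau>_def\<close>)
  next
    case (Cons z h')
    then show ?thesis using g[of "z - y"] stay by (simp add: \<tau>_def good_def)
  qed
  moreover have "\<exists>t. \<rho> t \<in> set (\<tau> (map \<rho> [1..<Suc t]))"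
    if \<rho>: "\<rho> 0 = y" "\<forall>t. \<rho> (Suc t) - \<rho> t \<in> T" for \<rho>
  proof -
    let ?r = "\<rho> 1 - y"
    have r: "?r \<in> T" using \<rho>(2)[rule_format, of 0] \<rho>(1) by simp
    have "\<forall>\<rho>. \<rho> 0 = y + ?r \<longrightarrow> (\<forall>t. \<rho> (Suc t) - \<rho> t \<in> T) \<longrightarrow>
        (\<exists>t. \<rho> t \<in> set (\<tau>' ?r (map \<rho> [1..<Suc t])))"
      using g[OF r] unfolding good_def by blast
    from this[rule_format, of "\<rho> \<circ> Suc"] obtain t
      where t: "\<rho> (Suc t) \<in> set (\<tau>' ?r (map (\<rho> \<circ> Suc) [1..<Suc t]))"
      using \<rho>(2) by auto
    have "map \<rho> [1..<Suc (Suc t)] = \<rho> 1 # map (\<rho> \<circ> Suc) [1..<Suc t]"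
      by (subst upt_conv_Cons) (simp_all add: map_Suc_upt[symmetric] del: upt_Suc)
    then have "\<tau> (map \<rho> [1..<Suc (Suc t)]) = \<tau>' ?r (map (\<rho> \<circ> Suc) [1..<Suc t])"
      using r by (simp add: \<tau>_def)
    then show ?thesis using t by metis
  qed
  ultimately show ?case
    by (intro exI[of _ \<tau>] conjI) (auto simp: \<tau>_def C_def)
qed

end

lemma capture_from_wins:
  fixes S :: "'a::{ab_group_add, finite} set"
  assumes "pursuit (sums_upto S s)" "pursuit.wins (sums_upto S s) {0} (sums_upto S s) k"
  shows "cops_guarantee_capture (with_proj (power_digraph (with_proj (cayley S)) s)) 1 1 k"
proof -
  interpret pursuit "sums_upto S s" by (rule assms(1))
  have "\<exists>\<tau>. \<tau> [] = replicate k 0 \<and>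
    (\<forall>h x. list_all2 (\<lambda>u v. v - u \<in> sums_upto S s) (\<tau> h) (\<tau> (h @ [x]))) \<and>
    (\<forall>\<rho>. \<rho> 0 = y \<longrightarrow> (\<forall>t. \<rho> (Suc t) - \<rho> t \<in> sums_upto S s) \<longrightarrow>
      (\<exists>t. \<rho> t \<in> set (\<tau> (map \<rho> [1..<Suc t]))))" for y
  proof -
    have "Win {0} (sums_upto S s) {..<k} (\<lambda>_. y)" using assms(2) by (simp add: wins_def)
    from strategy_from_Win[OF this, of y] show ?thesis
      by (simp add: map_replicate_const del: upt_Suc)
  qed
  then obtain \<tau> where \<tau>: "\<And>y. \<tau> y [] = replicate k 0"
    "\<And>y h x. list_all2 (\<lambda>u v. v - u \<in> sums_upto S s) (\<tau> y h) (\<tau> y (h @ [x]))"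
    "\<And>y \<rho>. \<rho> 0 = y \<Longrightarrow> \<forall>t. \<rho> (Suc t) - \<rho> t \<in> sums_upto S s \<Longrightarrow>
      \<exists>t. \<rho> t \<in> set (\<tau> y (map \<rho> [1..<Suc t]))"
    by metis
  \<comment> \<open>All cops start at \<open>0\<close> and, since \<open>Win\<close> has the robber
    to move, stand still in their first move; the robber's initial vertex \<open>y\<close> selects
    the strategy.\<close>
  define \<sigma> where "\<sigma> h = (case h of [] \<Rightarrow> replicate k 0 | y # h' \<Rightarrow> \<tau> y h')" for h
  have "list_all2 (\<lambda>u v. v - u \<in> sums_upto S s) (\<sigma> h) (\<sigma> (h @ [x]))" for h x
    using \<tau>(1,2) zero_in by (cases h) (auto simp: \<sigma>_def list_all2_same)
  then have "cop_strategy (with_proj (power_digraph (with_proj (cayley S)) s)) 1 k \<sigma>"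
    unfolding cop_strategy_iff by (simp add: \<sigma>_def)
  moreover have "\<exists>t. captured_at \<sigma> \<rho> t"
    if play: "robber_play (with_proj (power_digraph (with_proj (cayley S)) s)) 1 \<sigma> \<rho>" for \<rho>
  proof (rule ccontr)
    assume not: "\<nexists>t. captured_at \<sigma> \<rho> t"
    then have "\<forall>t. \<rho> (Suc t) - \<rho> t \<in> sums_upto S s"
      using play unfolding robber_play_def robber_move_power_iff by blast
    then obtain t where "\<rho> t \<in> set (\<tau> (\<rho> 0) (map \<rho> [1..<Suc t]))" using \<tau>(3) by blast
    moreover have "cops_at \<sigma> \<rho> (Suc t) = \<tau> (\<rho> 0) (map \<rho> [1..<Suc t])"
      by (simp add: cops_at_def \<sigma>_def upt_conv_Cons del: upt_Suc)
    ultimately have "captured_at \<sigma> \<rho> t" unfolding captured_at_def by simp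
    then show False using not by blast
  qed
  ultimately show ?thesis unfolding cops_guarantee_capture_def by blast
qed

lemma half_le_ceiling: "real ((m + 1) div 2) \<le> real_of_int \<lceil>1 / 2 * real m\<rceil>"
proof -
  define z where "z = \<lceil>1 / 2 * real m\<rceil>"
  have "1 / 2 * real m \<le> real_of_int z" unfolding z_def by (rule le_of_int_ceiling)
  then have "real_of_int (int m) \<le> real_of_int (2 * z)" by simp
  then have "int m \<le> 2 * z" by (simp only: of_int_le_iff)
  then have "int ((m + 1) div 2) \<le> z" by presburger
  then have "real_of_int (int ((m + 1) div 2)) \<le> real_of_int z" by (simp only: of_int_le_iff)
  then show ?thesis by (simp add: z_def)
qed

theorem theorem1p1:
  fixes S :: "'a::{ab_group_add, finite} set" and s :: nat
  assumes "CARD('a) \<ge> 2"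
    and "0 \<notin> S"
    and "strongly_connected (cayley S)"
    and "s \<ge> 1"
  shows "speed_cop_number s s (cayley S) = cop_number (power_digraph (cayley S) s) \<and>
    real (cop_number (power_digraph (cayley S) s)) \<le>
      min (sqrt (2 / (exp 1 * (sqrt 2 - 1))) * sqrt (real CARD('a)) + 2)
          (real ((card S + s) choose s)) \<and>
    (S = uminus ` S \<longrightarrow>
      real (cop_number (power_digraph (cayley S) s)) \<le>
        min (1 / sqrt (exp 1 * (sqrt 2 - 1)) * sqrt (real CARD('a)) + 7 / 2)
            (real_of_int \<lceil>1 / 2 * real ((card S + s) choose s)\<rceil>))"
proof -
  let ?T = "sums_upto S s"
  interpret pursuit ?T by (rule pursuit_sums_upto[OF assms(3,4)])
  let ?c = "cop_number (power_digraph (cayley S) s)"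
  have le: "?c \<le> k" if "wins {0} ?T k" for k
    unfolding speed_cop_number_def
    by (rule Least_le) (rule capture_from_wins[OF pursuit_axioms that])
  have eq: "speed_cop_number s s (cayley S) = ?c"
    by (simp only: speed_cop_number_def cops_guarantee_capture_power_iff)
  obtain k where k: "wins {0} ?T k" "real k \<le> directed_const * sqrt (real CARD('a)) + 2"
    using few_cops[OF assms(1)] by metis
  have sqrt_le: "real ?c \<le> sqrt (2 / (exp 1 * (sqrt 2 - 1))) * sqrt (real CARD('a)) + 2"
    using le[OF k(1)] k(2) unfolding directed_const_def by linarith
  have "wins {0} ?T (card ?T)" by (rule goodD[OF good_self]) auto
  then have binom_le: "?c \<le> (card S + s) choose s"
    using le card_sums_upto order.trans by blast
  have "real ?c \<le> 1 / sqrt (exp 1 * (sqrt 2 - 1)) * sqrt (real CARD('a)) + 7 / 2 \<and>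
    real ?c \<le> real_of_int \<lceil>1 / 2 * real ((card S + s) choose s)\<rceil>" if sym: "S = uminus ` S"
  proof
    interpret symmetric_pursuit ?T
      by unfold_locales (rule uminus_in_sums_upto[OF sym])
    obtain k where k: "wins {0} ?T k" "real k \<le> directed_const / sqrt 2 * sqrt (real CARD('a)) + 7 / 2"
      using few_cops_symmetric[OF assms(1)] by metis
    have const: "directed_const / sqrt 2 = 1 / sqrt (exp 1 * (sqrt 2 - 1))"
      by (simp add: directed_const_def real_sqrt_divide)
    from order.trans[OF of_nat_mono[OF le[OF k(1)]] k(2)]
    show "real ?c \<le> 1 / sqrt (exp 1 * (sqrt 2 - 1)) * sqrt (real CARD('a)) + 7 / 2"
      by (simp only: const)
    \<comment> \<open>Twice this number is at least \<open>card ?T\<close>, and \<open>0\<close>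
      lies in \<open>?T\<close>, so \<open>wins_even\<close> yields the rounded-up half without an
      additional cop.\<close>
    have "wins {0} ?T ((card ?T + 1) div 2)"
      by (rule wins_even) (auto simp: zero_in)
    then have "?c \<le> (card ?T + 1) div 2" by (rule le)
    also have "\<dots> \<le> (((card S + s) choose s) + 1) div 2"
      by (intro div_le_mono add_mono card_sums_upto order_refl)
    finally have "real ?c \<le> real ((((card S + s) choose s) + 1) div 2)" by simp
    also have "\<dots> \<le> real_of_int \<lceil>1 / 2 * real ((card S + s) choose s)\<rceil>"
      by (rule half_le_ceiling)
    finally show "real ?c \<le> real_of_int \<lceil>1 / 2 * real ((card S + s) choose s)\<rceil>" .
  qed
  then show ?thesis using eq sqrt_le binom_le by simp
qed

end
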